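(* Let $n,p\in\mathbb{N}$ and let $L:\mathbb{R}[x]_{\leq 2n}\to \mathbb{S}_p(\mathbb{R})$ be a linear operator with moments $S_i:=L(x^i)$, $i=0,1,\ldots,2n$, such that its $n$-th truncated moment matrix $M(n)=(S_{i+j-2})_{i,j=1}^{n+1}$ is positive definite. Fix $t\in\mathbb{R}$ and $m\in\mathbb{N}\cup\{0\}$. Let $\mathcal{H}:=(S_{i+j-1}-tS_{i+j-2})_{i,j=1}^{n}$. Then the following statements are equivalent: (1) There exists a minimal representing measure $\mu$ for $L$ such that $\operatorname{mult}_\mu t=m$. (2) $m\leq \operatorname{rank}\mathcal{H}-(n-1)p$.
   Context: $\mathbb{N}=\{1,2,\ldots\}$. $\mathbb{R}[x]_{\leq k}$ is the real vector space of univariate polynomials of degree at most $k$. $\mathbb{S}_p(\mathbb{R})$ is the space of real symmetric $p\times p$ matrices. $M(n)$ is the $(n+1)\times(n+1)$ block matrix, with $p\times p$ blocks, whose $(i,j)$ block is $S_{i+j-2}$, regarded as a real $(n+1)p\times(n+1)p$ matrix; similarly $\mathcal{H}$ is an $n\times n$ block matrix with $p\times p$ blocks, regarded as a real $np\times np$ matrix. A positive $\mathbb{S}_p(\mathbb{R})$-valued measure is a map $\mu=(\mu_{ij})_{i,j=1}^p$ from the Borel $\sigma$-algebra of $\mathbb{R}$ to $\mathbb{S}_p(\mathbb{R})$ such that each $\mu_{ij}$ is a real (signed) measure and $\mu(\Delta)$ is positive semidefinite for every Borel set $\Delta$. Integrals are taken entrywise: $\int f\,d\mu=(\int f\,d\mu_{ij})_{i,j}$,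 where $f$ is required to be integrable with respect to the trace measure $\sum_i\mu_{ii}$. It is a representing measure for $L$ if $L(q)=\int_{\mathbb{R}} q\,d\mu$ for every $q\in\mathbb{R}[x]_{\leq 2n}$. A finitely atomic representing measure $\mu=\sum_{j=1}^{\ell}A_j\delta_{x_j}$ for $L$, where each $A_j\in\mathbb{S}_p(\mathbb{R})$ is nonzero and positive semidefinite, the $x_j\in\mathbb{R}$ are pairwise distinct and $\delta_{x_j}$ is the Dirac measure at $x_j$, is called minimal if $\sum_{j=1}^{\ell}\operatorname{rank}A_j$ is minimal among all representing measures for $L$ of this form. The multiplicity of an atom is $\operatorname{mult}_\mu x_j:=\operatorname{rank}A_j=\operatorname{rank}\mu(\{x_j\})$, and $\operatorname{mult}_\mu x:=0$ if $x$ is not one of the atoms $x_j$. *)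

theory Defs
  imports
    "HOL-Analysis.Analysis"
    "HOL-Computational_Algebra.Polynomial"
    "Jordan_Normal_Form.DL_Rank"
begin

abbreviation mat_rank :: "real mat \<Rightarrow> nat" where
  "mat_rank A \<equiv> vec_space.rank (dim_row A) A"

definition sym_mats :: "nat \<Rightarrow> real mat set" where
  "sym_mats k = {A \<in> carrier_mat k k. transpose_mat A = A}"

definition pos_semidef :: "nat \<Rightarrow> real mat \<Rightarrow> bool" where
  "pos_semidef k A \<longleftrightarrow>
     A \<in> sym_mats k \<and> (\<forall>v \<in> carrier_vec k. scalar_prod v (A *\<^sub>v v) \<ge> 0)"

definition pos_def :: "nat \<Rightarrow> real mat \<Rightarrow> bool" where
  "pos_def k A \<longleftrightarrow>
     A \<in> sym_mats k \<and> (\<forall>v \<in> carrier_vec k. v \<noteq> 0\<^sub>v k \<longrightarrow> scalar_prod v (A *\<^sub>v v) > 0)"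

text \<open>Linear operators from the polynomials of degree at most \<open>d\<close> to the symmetric
  \<open>p \<times> p\<close> matrices; the values of \<open>L\<close> on polynomials of higher degree are irrelevant.\<close>

definition linear_op :: "nat \<Rightarrow> nat \<Rightarrow> (real poly \<Rightarrow> real mat) \<Rightarrow> bool" where
  "linear_op p d L \<longleftrightarrow>
     (\<forall>q. degree q \<le> d \<longrightarrow> L q \<in> sym_mats p) \<and>
     (\<forall>q r. degree q \<le> d \<longrightarrow> degree r \<le> d \<longrightarrow> L (q + r) = L q + L r) \<and>
     (\<forall>c q. degree q \<le> d \<longrightarrow> L (Polynomial.smult c q) = c \<cdot>\<^sub>m L q)"

definition moment :: "(real poly \<Rightarrow> real mat) \<Rightarrow> nat \<Rightarrow> real mat" where
  "moment L i = L (Polynomial.monom 1 i)"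

text \<open>The \<open>k \<times> k\<close> block matrix with \<open>p \<times> p\<close> blocks \<open>B i j\<close>, \<open>i, j < k\<close>.
  Block indices start at 0, so that the block \<open>S\<^bsub>i+j-2\<^esub>\<close> in one-based
  indexing becomes \<open>S\<^bsub>i+j\<^esub>\<close>, and \<open>S\<^bsub>i+j-1\<^esub>\<close> becomes \<open>S\<^bsub>i+j+1\<^esub>\<close>.\<close>

definition block_matrix :: "nat \<Rightarrow> nat \<Rightarrow> (nat \<Rightarrow> nat \<Rightarrow> real mat) \<Rightarrow> real mat" where
  "block_matrix p k B =
     mat (k * p) (k * p) (\<lambda>(a, b). B (a div p) (b div p) $$ (a mod p, b mod p))"

definition moment_matrix :: "nat \<Rightarrow> nat \<Rightarrow> (real poly \<Rightarrow> real mat) \<Rightarrow> real mat" where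
  "moment_matrix p n L = block_matrix p (n + 1) (\<lambda>i j. moment L (i + j))"

definition shifted_matrix :: "nat \<Rightarrow> nat \<Rightarrow> (real poly \<Rightarrow> real mat) \<Rightarrow> real \<Rightarrow> real mat" where
  "shifted_matrix p n L t =
     block_matrix p n (\<lambda>i j. moment L (i + j + 1) - t \<cdot>\<^sub>m moment L (i + j))"

text \<open>Real signed measures on the Borel sets of the line, as set functions; values on
  other sets are irrelevant. Integration is by the Jordan decomposition, whose parts are
  \<open>\<nu>\<^sup>+(\<Delta>) = sup {\<nu>(B) | B \<subseteq> \<Delta>}\<close> and \<open>\<nu>\<^sup>- = (-\<nu>)\<^sup>+\<close>
  (\<open>ennreal\<close> truncates negative values to 0, which is harmless since \<open>\<nu>({}) = 0\<close>).\<close>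

definition signed_measure :: "(real set \<Rightarrow> real) \<Rightarrow> bool" where
  "signed_measure \<nu> \<longleftrightarrow>
     \<nu> {} = 0 \<and>
     (\<forall>A :: nat \<Rightarrow> real set. range A \<subseteq> sets borel \<longrightarrow> disjoint_family A \<longrightarrow>
        (\<lambda>i. \<nu> (A i)) sums \<nu> (\<Union>i. A i))"

definition pos_variation :: "(real set \<Rightarrow> real) \<Rightarrow> real measure" where
  "pos_variation \<nu> =
     measure_of UNIV (sets borel) (\<lambda>\<Delta>. SUP B \<in> {B \<in> sets borel. B \<subseteq> \<Delta>}. ennreal (\<nu> B))"

definition signed_integral :: "(real set \<Rightarrow> real) \<Rightarrow> (real \<Rightarrow> real) \<Rightarrow> real" where
  "signed_integral \<nu> f =
     integral\<^sup>L (pos_variation \<nu>) f - integral\<^sup>L (pos_variation (\<lambda>B. - \<nu> B)) f"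

definition pos_matrix_measure :: "nat \<Rightarrow> (real set \<Rightarrow> real mat) \<Rightarrow> bool" where
  "pos_matrix_measure p \<mu> \<longleftrightarrow>
     (\<forall>\<Delta> \<in> sets borel. pos_semidef p (\<mu> \<Delta>)) \<and>
     (\<forall>i<p. \<forall>j<p. signed_measure (\<lambda>\<Delta>. \<mu> \<Delta> $$ (i, j)))"

definition trace_measure :: "nat \<Rightarrow> (real set \<Rightarrow> real mat) \<Rightarrow> real measure" where
  "trace_measure p \<mu> = measure_of UNIV (sets borel) (\<lambda>\<Delta>. ennreal (\<Sum>i<p. \<mu> \<Delta> $$ (i, i)))"

definition matrix_integral :: "nat \<Rightarrow> (real set \<Rightarrow> real mat) \<Rightarrow> (real \<Rightarrow> real) \<Rightarrow> real mat" where
  "matrix_integral p \<mu> f = mat p p (\<lambda>(i, j). signed_integral (\<lambda>\<Delta>. \<mu> \<Delta> $$ (i, j)) f)"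

definition representing_measure ::
    "nat \<Rightarrow> nat \<Rightarrow> (real poly \<Rightarrow> real mat) \<Rightarrow> (real set \<Rightarrow> real mat) \<Rightarrow> bool" where
  "representing_measure p n L \<mu> \<longleftrightarrow>
     pos_matrix_measure p \<mu> \<and>
     (\<forall>q. degree q \<le> 2 * n \<longrightarrow>
        integrable (trace_measure p \<mu>) (poly q) \<and> L q = matrix_integral p \<mu> (poly q))"

text \<open>\<open>\<mu> = \<Sum>\<^bsub>x \<in> X\<^esub> A x \<delta>\<^sub>x\<close> on Borel sets, with \<open>X\<close> the set of atoms.\<close>

definition atomic_form ::
    "nat \<Rightarrow> (real set \<Rightarrow> real mat) \<Rightarrow> real set \<Rightarrow> (real \<Rightarrow> real mat) \<Rightarrow> bool" where
  "atomic_form p \<mu> X A \<longleftrightarrow>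
     finite X \<and>
     (\<forall>x \<in> X. pos_semidef p (A x) \<and> A x \<noteq> 0\<^sub>m p p) \<and>
     (\<forall>\<Delta> \<in> sets borel. \<mu> \<Delta> = mat p p (\<lambda>(i, j). \<Sum>x\<in>X. A x $$ (i, j) * indicator \<Delta> x))"

definition minimal_measure ::
    "nat \<Rightarrow> nat \<Rightarrow> (real poly \<Rightarrow> real mat) \<Rightarrow> (real set \<Rightarrow> real mat) \<Rightarrow> bool" where
  "minimal_measure p n L \<mu> \<longleftrightarrow>
     representing_measure p n L \<mu> \<and>
     (\<exists>X A. atomic_form p \<mu> X A \<and>
        (\<forall>\<mu>' X' A'. representing_measure p n L \<mu>' \<and> atomic_form p \<mu>' X' A' \<longrightarrow>
           (\<Sum>x\<in>X. mat_rank (A x)) \<le> (\<Sum>x\<in>X'. mat_rank (A' x))))"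

text \<open>For a finitely atomic \<open>\<mu>\<close> this is the rank of the coefficient at the atom \<open>x\<close>, and
  0 if \<open>x\<close> is not an atom.\<close>

definition atom_mult :: "(real set \<Rightarrow> real mat) \<Rightarrow> real \<Rightarrow> nat" where
  "atom_mult \<mu> x = mat_rank (\<mu> {x})"

end

theory Submission
  imports Defs
begin

text \<open>
  Let \<open>\<langle>P, Q\<rangle>\<close> be the inner product that \<open>L\<close> defines on vector polynomials of degree at most \<open>n\<close>; its
  Gram matrix is the positive definite moment matrix \<open>M\<close>. A finitely atomic measure with weights \<open>A\<^sub>x\<close>
  represents \<open>L\<close> if and only if it reproduces the moments, and then
  \<open>\<langle>P, Q\<rangle> = \<Sum>x. P(x)\<^sup>T A\<^sub>x Q(x)\<close>.
  If the ranks of the weights added up to less than \<open>(n + 1) p\<close>, the equations \<open>A\<^sub>x P(x) = 0\<close> would have a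
  common nonzero solution, which is impossible (\<open>quadrature_size_ge\<close>).

  Measures of total rank \<open>(n + 1) p\<close> come from the form \<open>\<langle>(x - t) P, Q\<rangle>\<close>. Its matrix has the blocks
  \<open>H\<close> (the shifted matrix of the statement), \<open>h\<close> and \<open>h\<^sup>T\<close>, and a corner of size \<open>p\<close> that contains the
  missing moment of order \<open>2 n + 1\<close>. Fill the corner with any symmetric matrix, and diagonalize the result
  and \<open>M\<close> simultaneously. The Hankel structure forces \<open>M\<close> times an eigenvector to be geometric in the
  degree, so the diagonalization is a quadrature formula whose nodes are the eigenvalues shifted by \<open>t\<close>
  (\<open>quadrature_of_completion\<close>). Hence minimal measures have total rank \<open>(n + 1) p\<close>
  (\<open>minimal_measure_iff\<close>), and the measure obtained in this way gives \<open>t\<close> the nullity of the completed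
  matrix as its multiplicity.

  The theorem thus becomes a question about the nullity of completions. Multiplication by \<open>x - t\<close> is injective,
  so the block column formed by \<open>H\<close> and \<open>h\<^sup>T\<close> is injective (\<open>T_injective\<close>), and the space
  \<open>h\<^sup>T (ker H)\<close> has dimension \<open>n p - rank H\<close>. A kernel vector of a completion is determined by its leading
  coefficient, which is orthogonal to that space; so at most \<open>p - (n p - rank H)\<close> independent kernel vectors exist,
  and this number is the bound in the theorem. For measures the same argument is carried out directly on the
  polynomials that are annihilated at all atoms other than \<open>t\<close> (\<open>multiplicity_bound\<close>). Conversely,
  \<open>completion_with_nullity\<close> constructs a corner for every nullity up to this bound.
\<close>

section \<open>Homogeneous linear systems\<close>

text \<open>Gaussian elimination of one unknown per equation. Every dimension count below is an
  application of this fact. The index sets are arbitrary because some of the systems mix equations and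
  unknowns of several kinds.\<close>

lemma underdetermined_system:
  fixes a :: "'i \<Rightarrow> 'j \<Rightarrow> real"
  assumes "finite I" "finite J" "card I < card J"
  obtains x where "\<exists>j\<in>J. x j \<noteq> 0" "\<And>i. i \<in> I \<Longrightarrow> (\<Sum>j\<in>J. a i j * x j) = 0"
proof -
  have "\<exists>x. (\<exists>j\<in>J. x j \<noteq> 0) \<and> (\<forall>i\<in>I. (\<Sum>j\<in>J. a i j * x j) = 0)"
    using assms
  proof (induction I arbitrary: J a rule: finite_induct)
    case empty
    then obtain j where "j \<in> J" by (metis card.empty card_gt_0_iff equals0I)
    then show ?case by (intro exI[of _ "\<lambda>_. 1"]) auto
  next
    case (insert i I)
    show ?case
    proof (cases "\<exists>k\<in>J. a i k \<noteq> 0")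
      case False
      then have "card I < card J" using insert by auto
      from insert.IH[OF insert.prems(1) this, of a] False show ?thesis by auto
    next
      case True
      then obtain k where k: "k \<in> J" "a i k \<noteq> 0" by blast
      have "card I < card (J - {k})" using insert k by auto
      \<comment> \<open>Solve equation \<open>i\<close> for the unknown \<open>k\<close> and substitute into the others.\<close>
      from insert.IH[OF _ this, of "\<lambda>l j. a l j - a l k * a i j / a i k"] insert.prems(1)
      obtain x where x: "\<exists>j\<in>J - {k}. x j \<noteq> 0"
        and e: "\<And>l. l \<in> I \<Longrightarrow> (\<Sum>j\<in>J - {k}. (a l j - a l k * a i j / a i k) * x j) = 0"
        by auto
      define s where "s = (\<Sum>j\<in>J - {k}. a i j * x j)"
      define y where "y = x(k := - s / a i k)"
      have split: "(\<Sum>j\<in>J. a l j * y j) = (\<Sum>j\<in>J - {k}. a l j * x j) - a l k * s / a i k" for l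
        using insert.prems(1) k by (subst sum.remove[of J k]) (auto simp: y_def)
      have "(\<Sum>j\<in>J. a l j * y j) = 0" if "l \<in> I" for l
      proof -
        have "(\<Sum>j\<in>J - {k}. (a l j - a l k * a i j / a i k) * x j)
            = (\<Sum>j\<in>J - {k}. a l j * x j) - a l k * s / a i k"
          unfolding s_def sum_distrib_left sum_divide_distrib sum_subtractf[symmetric]
          by (intro sum.cong) (auto simp: algebra_simps)
        with e[OF that] split show ?thesis by simp
      qed
      moreover have "(\<Sum>j\<in>J. a i j * y j) = 0" using k by (simp add: split s_def[symmetric])
      moreover have "\<exists>j\<in>J. y j \<noteq> 0" using x by (auto simp: y_def)
      ultimately show ?thesis by blast
    qed
  qed
  then show ?thesis using that by blast
qed

section \<open>Bilinear forms on functions over a finite index set\<close>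

definition bform :: "'i set \<Rightarrow> ('i \<Rightarrow> 'i \<Rightarrow> real) \<Rightarrow> ('i \<Rightarrow> real) \<Rightarrow> ('i \<Rightarrow> real) \<Rightarrow> real" where
  "bform I A u v = (\<Sum>a\<in>I. \<Sum>b\<in>I. u a * A a b * v b)"

lemma bform_mult_right: "bform I A u v = (\<Sum>a\<in>I. u a * (\<Sum>b\<in>I. A a b * v b))"
  by (simp add: bform_def sum_distrib_left mult.assoc)

lemma bform_sym:
  assumes "\<And>a b. a \<in> I \<Longrightarrow> b \<in> I \<Longrightarrow> A a b = A b a"
  shows "bform I A u v = bform I A v u"
  unfolding bform_def by (subst sum.swap) (intro sum.cong refl, simp add: assms algebra_simps)

lemma bform_mult_left:
  assumes "\<And>a b. a \<in> I \<Longrightarrow> b \<in> I \<Longrightarrow> A a b = A b a"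
  shows "bform I A u v = (\<Sum>a\<in>I. (\<Sum>b\<in>I. A a b * u b) * v a)"
  using bform_sym[OF assms, where u = u and v = v] by (simp add: bform_mult_right mult.commute)

lemma bform_add_right: "bform I A u (\<lambda>a. v a + w a) = bform I A u v + bform I A u w"
  by (simp add: bform_def algebra_simps sum.distrib)

lemma bform_diff_right: "bform I A u (\<lambda>a. v a - w a) = bform I A u v - bform I A u w"
  by (simp add: bform_def algebra_simps sum_subtractf)

lemma bform_scale_right: "bform I A u (\<lambda>a. c * v a) = c * bform I A u v"
  by (simp add: bform_def sum_distrib_left algebra_simps)

lemma bform_sum_right: "bform I A u (\<lambda>a. \<Sum>k\<in>K. v k a) = (\<Sum>k\<in>K. bform I A u (v k))"
proof -
  have "bform I A u (\<lambda>a. \<Sum>k\<in>K. v k a) = (\<Sum>a\<in>I. \<Sum>b\<in>I. \<Sum>k\<in>K. u a * A a b * v k b)"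
    by (simp add: bform_def sum_distrib_left)
  also have "\<dots> = (\<Sum>a\<in>I. \<Sum>k\<in>K. \<Sum>b\<in>I. u a * A a b * v k b)"
    by (intro sum.cong refl sum.swap)
  also have "\<dots> = (\<Sum>k\<in>K. \<Sum>a\<in>I. \<Sum>b\<in>I. u a * A a b * v k b)" by (rule sum.swap)
  finally show ?thesis by (simp add: bform_def)
qed

lemma bform_cong:
  assumes "\<And>a. a \<in> I \<Longrightarrow> u a = u' a" "\<And>a. a \<in> I \<Longrightarrow> v a = v' a"
  shows "bform I A u v = bform I A u' v'"
  unfolding bform_def using assms by (intro sum.cong) auto

lemma bform_zero_right:
  assumes "\<And>a. a \<in> I \<Longrightarrow> v a = 0" shows "bform I A u v = 0"
  unfolding bform_def using assms by (intro sum.neutral) auto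

section \<open>Simultaneous diagonalization\<close>

text \<open>Coordinates outside \<open>I\<close> are pinned to 0, so that the cube is a product of compact intervals and
  Tychonoff's theorem applies although the ambient function space may be infinite-dimensional.\<close>

lemma compact_coordinate_cube:
  "compact {v :: 'i \<Rightarrow> real. \<forall>a. v a \<in> (if a \<in> I then {-1..1} else {0})}"
proof -
  have "compactin (product_topology (\<lambda>_. euclidean) UNIV)
      (PiE UNIV (\<lambda>a::'i. if a \<in> I then {-1..1::real} else {0}))"
    by (subst compactin_PiE) auto
  moreover have "PiE UNIV (\<lambda>a::'i. if a \<in> I then {-1..1::real} else {0})
      = {v. \<forall>a. v a \<in> (if a \<in> I then {-1..1} else {0})}"
    by (auto simp: PiE_def Pi_def)
  ultimately show ?thesis by (simp add: euclidean_product_topology)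
qed

text \<open>A pencil of two symmetric forms, the first positive definite: \<open>M\<close> plays the part of an inner
  product and \<open>B\<close> that of a self-adjoint operator; eigenvectors satisfy \<open>B v = \<rho> M v\<close>.\<close>

locale sym_pencil =
  fixes I :: "'i set" and M B :: "'i \<Rightarrow> 'i \<Rightarrow> real"
  assumes fin: "finite I"
    and M_sym: "\<And>a b. a \<in> I \<Longrightarrow> b \<in> I \<Longrightarrow> M a b = M b a"
    and B_sym: "\<And>a b. a \<in> I \<Longrightarrow> b \<in> I \<Longrightarrow> B a b = B b a"
    and M_pos: "\<And>u. \<exists>a\<in>I. u a \<noteq> 0 \<Longrightarrow> bform I M u u > 0"
begin

text \<open>The quotient \<open>B(v,v) / M(v,v)\<close> attains its maximum \<open>\<rho>\<close> on the Euclidean unit vectors that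
  are \<open>M\<close>-orthogonal to the given eigenvectors. At a maximizer \<open>v\<close> the nonnegative form \<open>\<rho> M - B\<close>
  vanishes, so \<open>v\<close> lies in its radical on the orthogonal complement; on the given eigenvectors
  \<open>\<rho> M v - B v\<close> vanishes by orthogonality. The two subspaces together span the whole space, which makes
  \<open>v\<close> an eigenvector.\<close>

lemma eigenvector_in_complement:
  fixes w :: "nat \<Rightarrow> 'i \<Rightarrow> real"
  assumes orth: "\<And>k l. k < j \<Longrightarrow> l < j \<Longrightarrow> bform I M (w k) (w l) = (if k = l then 1 else 0)"
    and eig: "\<And>k a. k < j \<Longrightarrow> a \<in> I \<Longrightarrow> (\<Sum>b\<in>I. B a b * w k b) = \<theta> k * (\<Sum>b\<in>I. M a b * w k b)"
    and u0: "\<exists>a\<in>I. u0 a \<noteq> 0" "\<And>k. k < j \<Longrightarrow> bform I M (w k) u0 = 0"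
  obtains v \<rho> where "\<exists>a\<in>I. v a \<noteq> 0" "\<And>k. k < j \<Longrightarrow> bform I M (w k) v = 0"
    "\<And>a. a \<in> I \<Longrightarrow> (\<Sum>b\<in>I. B a b * v b) = \<rho> * (\<Sum>b\<in>I. M a b * v b)"
proof -
  \<comment> \<open>The Euclidean sphere is used for compactness: the \<open>M\<close>-unit sphere would first need a lower
    bound of \<open>M\<close>, which is what compactness is to provide.\<close>
  define C where "C = {v :: 'i \<Rightarrow> real. \<forall>a. v a \<in> (if a \<in> I then {-1..1} else {0})}"
  define S where "S = C \<inter> {v. (\<Sum>a\<in>I. v a * v a) = 1} \<inter> {v. \<forall>k\<in>{..<j}. bform I M (w k) v = 0}"
  define R where "R v = bform I B v v / bform I M v v" for v
  have cont[continuous_intros]: "continuous_on T (\<lambda>v. v a)" for T and a :: 'i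
    by (rule continuous_on_subset[OF continuous_on_product_coordinates]) auto
  have contb: "continuous_on T (\<lambda>v. bform I A (f v) (g v))"
    if "\<And>a. continuous_on T (\<lambda>v. f v a)" "\<And>a. continuous_on T (\<lambda>v. g v a)"
    for T :: "('i \<Rightarrow> real) set" and f g A
    unfolding bform_def by (intro continuous_intros that)
  have "closed {v :: 'i \<Rightarrow> real. (\<Sum>a\<in>I. v a * v a) = 1}"
    by (intro closed_Collect_eq continuous_intros)
  moreover have "closed {v. \<forall>k\<in>{..<j}. bform I M (w k) v = 0}"
    by (subst Collect_ball_eq) (intro closed_INT ballI closed_Collect_eq contb continuous_intros)
  ultimately have "compact S" unfolding S_def C_def
    by (intro compact_Int_closed compact_coordinate_cube)
  have normalise: "\<exists>c v. c > 0 \<and> v \<in> S \<and> (\<forall>a\<in>I. u a = c * v a)"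
    if u: "\<exists>a\<in>I. u a \<noteq> 0" and o: "\<And>k. k < j \<Longrightarrow> bform I M (w k) u = 0" for u
  proof -
    define q where "q = (\<Sum>a\<in>I. u a * u a)"
    obtain a where a: "a \<in> I" "u a \<noteq> 0" using u by blast
    have le: "u b * u b \<le> q" if "b \<in> I" for b
      unfolding q_def using that fin by (intro member_le_sum) auto
    have q: "q > 0" using le[OF a(1)] a(2) by (metis less_le_trans not_real_square_gt_zero)
    define v where "v b = (if b \<in> I then u b / sqrt q else 0)" for b
    have "\<bar>u b\<bar> \<le> sqrt q" if "b \<in> I" for b
      using le[OF that] by (metis power2_eq_square real_sqrt_abs real_sqrt_le_iff)
    then have "- sqrt q \<le> u b \<and> u b \<le> sqrt q" if "b \<in> I" for b using that by (fastforce simp: abs_le_iff)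
    then have "v \<in> C" using q by (auto simp: C_def v_def divide_simps)
    moreover have "(\<Sum>b\<in>I. v b * v b) = 1"
    proof -
      have "(\<Sum>b\<in>I. v b * v b) = (\<Sum>b\<in>I. u b * u b / q)"
        using q by (intro sum.cong) (auto simp: v_def)
      also have "\<dots> = 1" using q by (simp add: sum_divide_distrib[symmetric] q_def)
      finally show ?thesis .
    qed
    moreover have "bform I M (w k) v = 0" if "k < j" for k
    proof -
      have "bform I M (w k) v = bform I M (w k) (\<lambda>b. (1 / sqrt q) * u b)"
        by (intro bform_cong) (auto simp: v_def)
      then show ?thesis using o[OF that] by (simp add: bform_scale_right del: times_divide_eq_left)
    qed
    ultimately show ?thesis using q
      by (intro exI[of _ "sqrt q"] exI[of _ v]) (auto simp: S_def v_def)
  qed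
  have S_pos: "bform I M v v > 0" if "v \<in> S" for v
  proof (rule M_pos, rule ccontr)
    assume "\<not> (\<exists>a\<in>I. v a \<noteq> 0)"
    then have "(\<Sum>a\<in>I. v a * v a) = 0" by (intro sum.neutral) auto
    then show False using that by (auto simp: S_def)
  qed
  have "S \<noteq> {}" using normalise[OF u0] by auto
  moreover have "continuous_on S R" unfolding R_def
    using S_pos by (intro continuous_intros contb) force+
  ultimately obtain v where v: "v \<in> S" and max: "\<And>u. u \<in> S \<Longrightarrow> R u \<le> R v"
    using continuous_attains_sup[OF \<open>compact S\<close>] by blast
  define \<rho> where "\<rho> = R v"
  have v_orth: "bform I M (w k) v = 0" if "k < j" for k using v that by (auto simp: S_def)
  have v_nz: "\<exists>a\<in>I. v a \<noteq> 0"
    using S_pos[OF v] by (rule contrapos_pp) (auto simp: bform_def)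
  have v_eq: "\<rho> * bform I M v v - bform I B v v = 0"
    using S_pos[OF v] by (simp add: \<rho>_def R_def)
  have nonneg: "0 \<le> \<rho> * bform I M u u - bform I B u u"
    if "\<And>k. k < j \<Longrightarrow> bform I M (w k) u = 0" for u
  proof (cases "\<exists>a\<in>I. u a \<noteq> 0")
    case False
    then show ?thesis by (simp add: bform_def)
  next
    case True
    from normalise[OF this that] obtain c y where y: "c > 0" "y \<in> S" "\<forall>a\<in>I. u a = c * y a" by blast
    have sc: "bform I A u u = c^2 * bform I A y y" for A
      using y(3) by (simp add: bform_def sum_distrib_left power2_eq_square algebra_simps)
    have "bform I B y y \<le> \<rho> * bform I M y y"
      using max[OF y(2)] S_pos[OF y(2)] by (simp add: \<rho>_def R_def[of y] divide_simps)
    then have "c^2 * bform I B y y \<le> c^2 * (\<rho> * bform I M y y)" by (rule mult_left_mono) auto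
    then show ?thesis by (simp add: sc algebra_simps)
  qed
  \<comment> \<open>A nonnegative quadratic form is isotropic only on its radical.\<close>
  have crit: "\<rho> * bform I M v u - bform I B v u = 0"
    if o: "\<And>k. k < j \<Longrightarrow> bform I M (w k) u = 0" for u
  proof -
    define g where "g = \<rho> * bform I M v u - bform I B v u"
    define q where "q = \<rho> * bform I M u u - bform I B u u"
    have q: "q \<ge> 0" unfolding q_def by (rule nonneg[OF o])
    have quad: "0 \<le> 2 * s * g + s^2 * q" for s
    proof -
      have "bform I M (w k) (\<lambda>a. v a + s * u a) = 0" if "k < j" for k
        using v_orth[OF that] o[OF that] by (simp add: bform_add_right bform_scale_right)
      from nonneg[OF this] have "0 \<le> \<rho> * bform I M (\<lambda>a. v a + s * u a) (\<lambda>a. v a + s * u a)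
          - bform I B (\<lambda>a. v a + s * u a) (\<lambda>a. v a + s * u a)" by simp
      moreover have "bform I A (\<lambda>a. v a + s * u a) (\<lambda>a. v a + s * u a)
          = bform I A v v + 2 * s * bform I A v u + s^2 * bform I A u u"
        if "\<And>a b. a \<in> I \<Longrightarrow> b \<in> I \<Longrightarrow> A a b = A b a" for A
        using bform_sym[OF that, where u = "\<lambda>a. v a + s * u a" and v = v]
          bform_sym[OF that, where u = "\<lambda>a. v a + s * u a" and v = u] bform_sym[OF that, where u = v and v = u]
        by (simp add: bform_add_right bform_scale_right power2_eq_square algebra_simps)
      ultimately show ?thesis using v_eq M_sym B_sym by (simp add: g_def q_def algebra_simps)
    qed
    have "g^2 \<le> 0"
    proof -
      \<comment> \<open>The minimizer of the quadratic polynomial would be \<open>-g/q\<close>; adding 1 avoids \<open>q = 0\<close>.\<close>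
      have "2 * (-g/(q+1)) * g + (-g/(q+1))^2 * q = - (g^2 * (q + 2) / (q+1)^2)"
        using q by (simp add: divide_simps power2_eq_square) (simp add: algebra_simps)
      then have "g^2 * (q + 2) / (q+1)^2 \<le> 0" using quad[of "-g/(q+1)"] by simp
      then show ?thesis using q by (simp add: divide_le_0_iff mult_le_0_iff)
    qed
    then show ?thesis by (simp add: g_def)
  qed
  have cross: "\<rho> * bform I M v (w k) - bform I B v (w k) = 0" if "k < j" for k
  proof -
    have "bform I B v (w k) = \<theta> k * bform I M v (w k)"
      using eig[OF that] by (simp add: bform_mult_right sum_distrib_left algebra_simps)
    then show ?thesis using v_orth[OF that] bform_sym[OF M_sym, where u = v and v = "w k"] by simp
  qed
  have "(\<Sum>b\<in>I. B a b * v b) = \<rho> * (\<Sum>b\<in>I. M a b * v b)" if a: "a \<in> I" for a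
  proof -
    \<comment> \<open>Split the unit vector \<open>e\<close> into its projection \<open>p\<close> onto the given eigenvectors and a remainder
      in their complement.\<close>
    define e where "e b = (if b = a then 1 else 0 :: real)" for b
    define p where "p b = (\<Sum>k<j. bform I M (w k) e * w k b)" for b
    have "bform I M (w k) (\<lambda>b. e b - p b) = 0" if "k < j" for k
    proof -
      have "bform I M (w k) p = (\<Sum>l<j. bform I M (w l) e * bform I M (w k) (w l))"
        unfolding p_def by (simp add: bform_sum_right bform_scale_right)
      also have "\<dots> = (\<Sum>l<j. if l = k then bform I M (w k) e else 0)"
        using orth that by (intro sum.cong) auto
      finally show ?thesis using that by (simp add: bform_diff_right)
    qed
    from crit[OF this] have 1: "\<rho> * bform I M v (\<lambda>b. e b - p b) - bform I B v (\<lambda>b. e b - p b) = 0" by simp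
    have "\<rho> * bform I M v p - bform I B v p
        = (\<Sum>l<j. bform I M (w l) e * (\<rho> * bform I M v (w l) - bform I B v (w l)))"
      unfolding p_def
      by (simp only: bform_sum_right bform_scale_right sum_distrib_left sum_subtractf[symmetric])
        (simp add: algebra_simps)
    also have "\<dots> = 0" using cross by (intro sum.neutral) auto
    finally have "\<rho> * bform I M v e - bform I B v e = 0" using 1 by (simp add: bform_diff_right algebra_simps)
    moreover have "bform I A v e = (\<Sum>b\<in>I. A a b * v b)"
      if "\<And>a b. a \<in> I \<Longrightarrow> b \<in> I \<Longrightarrow> A a b = A b a" for A
      using a fin by (subst bform_mult_left[OF that]) (auto simp: e_def if_distrib cong: if_cong)
    ultimately show ?thesis using M_sym B_sym by simp
  qed
  with v_nz v_orth show ?thesis using that by blast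
qed

lemma orthonormal_eigenvectors:
  "j \<le> card I \<Longrightarrow> \<exists>w \<theta>. (\<forall>k<j. \<forall>l<j. bform I M (w k) (w l) = (if k = l then 1 else 0)) \<and>
     (\<forall>k<j. \<forall>a\<in>I. (\<Sum>b\<in>I. B a b * w k b) = \<theta> k * (\<Sum>b\<in>I. M a b * w k b))"
proof (induction j)
  case 0
  then show ?case by auto
next
  case (Suc j)
  then obtain w \<theta> where orth: "\<And>k l. k < j \<Longrightarrow> l < j \<Longrightarrow> bform I M (w k) (w l) = (if k = l then 1 else 0)"
    and eig: "\<And>k a. k < j \<Longrightarrow> a \<in> I \<Longrightarrow> (\<Sum>b\<in>I. B a b * w k b) = \<theta> k * (\<Sum>b\<in>I. M a b * w k b)"
    by (metis Suc_leD)
  obtain u where u: "\<exists>a\<in>I. u a \<noteq> 0" "\<And>k. k \<in> {..<j} \<Longrightarrow> (\<Sum>a\<in>I. (\<Sum>b\<in>I. M a b * w k b) * u a) = 0"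
    using underdetermined_system[of "{..<j}" I "\<lambda>k a. \<Sum>b\<in>I. M a b * w k b"] fin Suc.prems by auto
  then have "bform I M (w k) u = 0" if "k < j" for k
    using that by (subst bform_mult_left[OF M_sym]) auto
  from eigenvector_in_complement[OF orth eig u(1) this] obtain v \<rho> where
    v: "\<exists>a\<in>I. v a \<noteq> 0" "\<And>k. k < j \<Longrightarrow> bform I M (w k) v = 0"
    "\<And>a. a \<in> I \<Longrightarrow> (\<Sum>b\<in>I. B a b * v b) = \<rho> * (\<Sum>b\<in>I. M a b * v b)" by blast
  define r where "r = sqrt (bform I M v v)"
  have r: "r > 0" "r * r = bform I M v v" using M_pos[OF v(1)] by (auto simp: r_def)
  define v' where "v' = (\<lambda>a. (1 / r) * v a)"
  have v': "bform I M (w k) v' = 0" "bform I M v' (w k) = 0" if "k < j" for k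
    using v(2)[OF that] bform_sym[OF M_sym, where u = v' and v = "w k"]
    by (simp_all add: v'_def bform_scale_right del: times_divide_eq_left)
  have "bform I M v' v' = (1/r) * (1/r) * bform I M v v"
    using bform_sym[OF M_sym, where u = v' and v = v]
    by (simp add: v'_def bform_scale_right del: times_divide_eq_left)
  then have v'1: "bform I M v' v' = 1" using r(1) by (simp add: r(2)[symmetric])
  have v'2: "(\<Sum>b\<in>I. B a b * v' b) = \<rho> * (\<Sum>b\<in>I. M a b * v' b)" if "a \<in> I" for a
    using v(3)[OF that] unfolding v'_def by (simp add: sum_divide_distrib[symmetric])
  show ?case
    using orth eig v' v'1 v'2
    by (intro exI[of _ "w(j := v')"] exI[of _ "\<theta>(j := \<rho>)"]) (auto simp: less_Suc_eq)
qed

theorem simultaneous_diagonalization: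
  obtains w :: "nat \<Rightarrow> 'i \<Rightarrow> real" and \<theta> where
    "\<And>k l. k < card I \<Longrightarrow> l < card I \<Longrightarrow> bform I M (w k) (w l) = (if k = l then 1 else 0)"
    "\<And>k a. k < card I \<Longrightarrow> a \<in> I \<Longrightarrow> (\<Sum>b\<in>I. B a b * w k b) = \<theta> k * (\<Sum>b\<in>I. M a b * w k b)"
  using orthonormal_eigenvectors[of "card I"] by blast

text \<open>If \<open>u\<close> were nonzero, \<open>u\<close> and the \<open>w k\<close> would be \<open>card I + 1\<close> vectors in dimension \<open>card I\<close>;
  a linear relation between them has only zero coefficients, by pairing it with each of them.\<close>

lemma orthonormal_complete:
  assumes orth: "\<And>k l. k < card I \<Longrightarrow> l < card I \<Longrightarrow> bform I M (w k) (w l) = (if k = l then 1 else 0)"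
    and u: "\<And>k. k < card I \<Longrightarrow> bform I M (w k) u = 0" and "a \<in> I"
  shows "u a = 0"
proof (rule ccontr)
  assume nz: "u a \<noteq> 0"
  define y where "y k = (if k = card I then u else w k)" for k
  obtain \<xi> where \<xi>: "\<exists>k\<in>{..card I}. \<xi> k \<noteq> 0" and z: "\<And>b. b \<in> I \<Longrightarrow> (\<Sum>k\<le>card I. y k b * \<xi> k) = 0"
    using underdetermined_system[of I "{..card I}" "\<lambda>b k. y k b"] fin by auto
  have dot: "(\<Sum>k\<le>card I. \<xi> k * bform I M f (y k)) = 0" for f
  proof -
    have "(\<Sum>k\<le>card I. \<xi> k * bform I M f (y k)) = bform I M f (\<lambda>b. \<Sum>k\<le>card I. \<xi> k * y k b)"
      by (simp add: bform_sum_right bform_scale_right)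
    also have "\<dots> = 0" using z by (intro bform_zero_right) (auto simp: mult.commute)
    finally show ?thesis .
  qed
  have "\<xi> l = 0" if "l < card I" for l
  proof -
    have "(\<Sum>k\<le>card I. \<xi> k * bform I M (w l) (y k)) = (\<Sum>k\<le>card I. if k = l then \<xi> l else 0)"
      using that orth u by (intro sum.cong) (auto simp: y_def)
    with dot show ?thesis using that by simp
  qed
  moreover from this have "\<xi> (card I) * bform I M u u = 0"
    using dot[of u] by (simp add: lessThan_Suc_atMost[symmetric] y_def)
  moreover have "bform I M u u > 0" using M_pos nz \<open>a \<in> I\<close> by blast
  ultimately show False using \<xi> by (auto simp: le_less)
qed

lemma orthonormal_expansion:
  assumes orth: "\<And>k l. k < card I \<Longrightarrow> l < card I \<Longrightarrow> bform I M (w k) (w l) = (if k = l then 1 else 0)"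
    and "a \<in> I"
  shows "u a = (\<Sum>k<card I. bform I M (w k) u * w k a)"
proof -
  have "bform I M (w l) (\<lambda>a. u a - (\<Sum>k<card I. bform I M (w k) u * w k a)) = 0" if "l < card I" for l
  proof -
    have "bform I M (w l) (\<lambda>a. \<Sum>k<card I. bform I M (w k) u * w k a)
        = (\<Sum>k<card I. bform I M (w k) u * bform I M (w l) (w k))"
      by (simp add: bform_sum_right bform_scale_right)
    also have "\<dots> = (\<Sum>k<card I. if k = l then bform I M (w l) u else 0)"
      using orth that by (intro sum.cong) auto
    finally show ?thesis using that by (simp add: bform_diff_right)
  qed
  from orthonormal_complete[OF orth this \<open>a \<in> I\<close>] show ?thesis by simp
qed

text \<open>In matrix terms: if the columns of \<open>W\<close> are \<open>M\<close>-orthonormal, then \<open>M = V V\<^sup>T\<close> with \<open>V = M W\<close>.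
  For a moment matrix this identity is the quadrature formula.\<close>

lemma orthonormal_factorization:
  assumes orth: "\<And>k l. k < card I \<Longrightarrow> l < card I \<Longrightarrow> bform I M (w k) (w l) = (if k = l then 1 else 0)"
    and a: "a \<in> I" "b \<in> I"
  shows "M a b = (\<Sum>k<card I. (\<Sum>c\<in>I. M a c * w k c) * (\<Sum>c\<in>I. M b c * w k c))"
proof -
  define e where "e c = (if c = b then 1 else 0 :: real)" for c
  have e: "bform I M (w k) e = (\<Sum>c\<in>I. M b c * w k c)" for k
    using a fin by (subst bform_mult_left[OF M_sym]) (auto simp: e_def if_distrib cong: if_cong)
  have "M a b = (\<Sum>c\<in>I. M a c * e c)" using a fin by (simp add: e_def if_distrib cong: if_cong)
  also have "\<dots> = (\<Sum>c\<in>I. M a c * (\<Sum>k<card I. bform I M (w k) e * w k c))"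
    using orthonormal_expansion[OF orth, of _ e] by (intro sum.cong) auto
  also have "\<dots> = (\<Sum>c\<in>I. \<Sum>k<card I. bform I M (w k) e * (M a c * w k c))"
    by (simp add: sum_distrib_left algebra_simps)
  also have "\<dots> = (\<Sum>k<card I. \<Sum>c\<in>I. bform I M (w k) e * (M a c * w k c))" by (rule sum.swap)
  finally show ?thesis unfolding sum_distrib_left[symmetric] e by (simp add: mult.commute)
qed

end

text \<open>The number of zero eigenvalues is the nullity of \<open>B\<close>. That the nullity is \<open>m\<close> is expressed by
  \<open>m\<close> functionals that separate the kernel from 0 (upper bound) and \<open>m\<close> independent kernel vectors
  (lower bound), because this is how a kernel is produced in the completion problem below.\<close>

lemma (in sym_pencil) card_zero_eigenvalues:
  assumes orth: "\<And>k l. k < card I \<Longrightarrow> l < card I \<Longrightarrow> bform I M (w k) (w l) = (if k = l then 1 else 0)"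
    and eig: "\<And>k a. k < card I \<Longrightarrow> a \<in> I \<Longrightarrow> (\<Sum>b\<in>I. B a b * w k b) = \<theta> k * (\<Sum>b\<in>I. M a b * w k b)"
    and upper: "\<And>u. (\<And>a. a \<in> I \<Longrightarrow> (\<Sum>b\<in>I. B a b * u b) = 0) \<Longrightarrow>
       (\<And>l. l < m \<Longrightarrow> (\<Sum>c\<in>C. f l c * u c) = 0) \<Longrightarrow> \<forall>a\<in>I. u a = 0"
    and ker: "\<And>l a. l < m \<Longrightarrow> a \<in> I \<Longrightarrow> (\<Sum>b\<in>I. B a b * P l b) = 0"
    and indep: "\<And>\<xi>. (\<And>a. a \<in> I \<Longrightarrow> (\<Sum>l<m. \<xi> l * P l a) = 0) \<Longrightarrow> \<forall>l<m. \<xi> l = 0"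
  shows "card {k. k < card I \<and> \<theta> k = 0} = m"
proof (rule antisym; rule ccontr)
  define Z where "Z = {k. k < card I \<and> \<theta> k = 0}"
  have finZ: "finite Z" by (simp add: Z_def)
  have apply_comb: "(\<Sum>b\<in>S. g b * (\<Sum>l\<in>K. \<xi> l * v l b)) = (\<Sum>l\<in>K. \<xi> l * (\<Sum>b\<in>S. g b * v l b))"
    for S :: "'a set" and K :: "nat set" and g :: "'a \<Rightarrow> real" and \<xi> :: "nat \<Rightarrow> real" and v
  proof -
    have "(\<Sum>b\<in>S. g b * (\<Sum>l\<in>K. \<xi> l * v l b)) = (\<Sum>b\<in>S. \<Sum>l\<in>K. \<xi> l * (g b * v l b))"
      by (simp add: sum_distrib_left mult_ac)
    also have "\<dots> = (\<Sum>l\<in>K. \<Sum>b\<in>S. \<xi> l * (g b * v l b))" by (rule sum.swap)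
    finally show ?thesis by (simp add: sum_distrib_left)
  qed
  {
    assume "\<not> card {k. k < card I \<and> \<theta> k = 0} \<le> m"
    then have "card {..<m} < card Z" by (simp add: Z_def)
    then obtain \<xi> where \<xi>: "\<exists>k\<in>Z. \<xi> k \<noteq> 0"
      and z: "\<And>l. l \<in> {..<m} \<Longrightarrow> (\<Sum>k\<in>Z. (\<Sum>c\<in>C. f l c * w k c) * \<xi> k) = 0"
      using underdetermined_system[of "{..<m}" Z "\<lambda>l k. \<Sum>c\<in>C. f l c * w k c"] finZ by blast
    define u where "u a = (\<Sum>k\<in>Z. \<xi> k * w k a)" for a
    have "\<forall>a\<in>I. u a = 0"
    proof (rule upper)
      fix a assume "a \<in> I"
      then show "(\<Sum>b\<in>I. B a b * u b) = 0"
        using eig by (simp add: u_def apply_comb Z_def)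
    next
      fix l assume "l < m"
      then show "(\<Sum>c\<in>C. f l c * u c) = 0" using z[of l] by (simp add: u_def apply_comb mult.commute)
    qed
    then have u0: "bform I M (w k) u = 0" for k by (intro bform_zero_right) auto
    have "\<xi> k = 0" if k: "k \<in> Z" for k
    proof -
      have "bform I M (w k) u = (\<Sum>l\<in>Z. \<xi> l * bform I M (w k) (w l))"
        unfolding u_def by (simp add: bform_sum_right bform_scale_right)
      also have "\<dots> = (\<Sum>l\<in>Z. if l = k then \<xi> k else 0)"
        using orth k by (intro sum.cong) (auto simp: Z_def)
      finally show ?thesis using k finZ u0 by simp
    qed
    then show False using \<xi> by blast
  next
    assume "\<not> m \<le> card {k. k < card I \<and> \<theta> k = 0}"
    then have "card Z < card {..<m}" by (simp add: Z_def)
    then obtain \<xi> where \<xi>: "\<exists>l\<in>{..<m}. \<xi> l \<noteq> 0"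
      and z: "\<And>k. k \<in> Z \<Longrightarrow> (\<Sum>l<m. bform I M (w k) (P l) * \<xi> l) = 0"
      using underdetermined_system[of Z "{..<m}" "\<lambda>k l. bform I M (w k) (P l)"] finZ by blast
    define u where "u a = (\<Sum>l<m. \<xi> l * P l a)" for a
    have Bu: "(\<Sum>b\<in>I. B a b * u b) = 0" if "a \<in> I" for a
      using ker[OF _ that] by (simp add: u_def apply_comb)
    have "bform I M (w k) u = 0" if k: "k < card I" for k
    proof (cases "\<theta> k = 0")
      case True
      then have "(\<Sum>l<m. bform I M (w k) (P l) * \<xi> l) = 0" using z k by (simp add: Z_def)
      then show ?thesis unfolding u_def by (simp add: bform_sum_right bform_scale_right mult.commute)
    next
      case False
      have "bform I B (w k) u = 0" using Bu by (simp add: bform_mult_right)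
      moreover have "bform I B (w k) u = (\<Sum>a\<in>I. (\<Sum>b\<in>I. B a b * w k b) * u a)"
        by (rule bform_mult_left[OF B_sym])
      moreover have "\<dots> = \<theta> k * (\<Sum>a\<in>I. (\<Sum>b\<in>I. M a b * w k b) * u a)"
        using eig[OF k] by (simp add: mult.assoc flip: sum_distrib_left)
      moreover have "(\<Sum>a\<in>I. (\<Sum>b\<in>I. M a b * w k b) * u a) = bform I M (w k) u"
        by (rule bform_mult_left[OF M_sym, symmetric])
      ultimately show ?thesis using False by simp
    qed
    then have "u a = 0" if "a \<in> I" for a using orthonormal_complete[OF orth _ that] by blast
    then have "\<forall>l<m. \<xi> l = 0" by (intro indep) (simp add: u_def)
    then show False using \<xi> by blast
  }
qed

section \<open>Matrix rank as a number of linear conditions\<close>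

lemma column_basis:
  assumes A: "A \<in> carrier_mat nr nc"
  obtains S where "finite S" "S \<subseteq> set (cols A)" "card S = mat_rank A"
    "\<forall>c. (\<forall>i<nr. (\<Sum>s\<in>S. c s * vec_index s i) = 0) \<longrightarrow> (\<forall>s\<in>S. c s = 0)"
    "\<forall>j<nc. \<exists>c. \<forall>i<nr. A $$ (i, j) = (\<Sum>s\<in>S. c s * vec_index s i)"
proof -
  interpret vec_space "TYPE(real)" nr .
  obtain S where S: "maximal S (\<lambda>T. T \<subseteq> set (cols A) \<and> lin_indpt T)" and "finite S"
    using maximal_exists_superset[of "set (cols A)" "\<lambda>T. T \<subseteq> set (cols A) \<and> lin_indpt T" "{}"]
    by (auto simp: lin_dep_def)
  then have sub: "S \<subseteq> set (cols A)" and li: "lin_indpt S" by (auto simp: maximal_def)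
  have carr: "set (cols A) \<subseteq> carrier_vec nr" using cols_dim[of A] A by simp
  then have Sc: "S \<subseteq> carrier_vec nr" using sub by blast
  have crd: "card S = mat_rank A" using rank_card_indpt[OF A S] A by simp
  have indep: "\<forall>s\<in>S. c s = 0" if z: "\<And>i. i < nr \<Longrightarrow> (\<Sum>s\<in>S. c s * vec_index s i) = 0" for c
  proof -
    have "lincomb c S = 0\<^sub>v nr"
      using z lincomb_index[OF _ Sc] lincomb_dim[OF \<open>finite S\<close> Sc] by (intro eq_vecI) auto
    then have "c \<in> S \<rightarrow> {0}" using not_lindepD[OF li \<open>finite S\<close> subset_refl, of c] by (simp add: class_ring_simps)
    then show ?thesis by blast
  qed
  have spans: "\<exists>c. \<forall>i<nr. A $$ (i, j) = (\<Sum>s\<in>S. c s * vec_index s i)" if j: "j < nc" for j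
  proof -
    have cj: "col A j \<in> set (cols A)" using A j by (simp add: cols_def)
    have "col A j \<in> span S"
    proof (rule ccontr)
      assume n: "col A j \<notin> span S"
      then have "lin_indpt (insert (col A j) S)" "col A j \<notin> S"
        using lin_dep_iff_in_span[OF Sc li] cj carr span_mem[OF Sc] by auto
      then show False using S cj sub unfolding maximal_def by blast
    qed
    then obtain c where "col A j = lincomb c S" using finite_in_span[OF \<open>finite S\<close> Sc] by metis
    then have "A $$ (i, j) = (\<Sum>s\<in>S. c s * vec_index s i)" if "i < nr" for i
      using lincomb_index[OF that Sc, of c] index_col[of i A j] A j that by simp
    then show ?thesis by blast
  qed
  show ?thesis using that[OF \<open>finite S\<close> sub crd] indep spans by blast
qed

text \<open>Together with the converse estimate below this describes the rank as the least number of linear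
  functionals whose common kernel lies in the kernel of \<open>A\<close>. In this form ranks enter the counting of
  equations directly. The functionals are the coordinates of the columns in a basis of the column space.\<close>

lemma mat_rank_functionals:
  assumes A: "A \<in> carrier_mat nr nc"
  obtains \<phi> :: "nat \<Rightarrow> nat \<Rightarrow> real" where
    "\<And>q i. (\<And>l. l < mat_rank A \<Longrightarrow> (\<Sum>j<nc. \<phi> l j * q j) = 0) \<Longrightarrow> i < nr \<Longrightarrow>
       (\<Sum>j<nc. A $$ (i, j) * q j) = 0"
proof -
  obtain S where S: "finite S" "S \<subseteq> set (cols A)" "card S = mat_rank A"
    and "\<forall>c. (\<forall>i<nr. (\<Sum>s\<in>S. c s * vec_index s i) = 0) \<longrightarrow> (\<forall>s\<in>S. c s = 0)"
    and span: "\<forall>j<nc. \<exists>c. \<forall>i<nr. A $$ (i, j) = (\<Sum>s\<in>S. c s * vec_index s i)"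
    by (rule column_basis[OF A])
  have "\<forall>j\<in>{..<nc}. \<exists>c. \<forall>i<nr. A $$ (i, j) = (\<Sum>s\<in>S. c s * vec_index s i)" using span by blast
  then obtain c where c: "\<forall>j\<in>{..<nc}. \<forall>i<nr. A $$ (i, j) = (\<Sum>s\<in>S. c j s * vec_index s i)"
    unfolding bchoice_iff by blast
  obtain e where e: "bij_betw e {..<mat_rank A} S"
    using ex_bij_betw_nat_finite[OF S(1)] S(3) by (auto simp: atLeast0LessThan)
  show ?thesis
  proof (rule that[of "\<lambda>l j. c j (e l)"])
    fix q :: "nat \<Rightarrow> real" and i
    assume z: "\<And>l. l < mat_rank A \<Longrightarrow> (\<Sum>j<nc. c j (e l) * q j) = 0" and i: "i < nr"
    have "(\<Sum>j<nc. A $$ (i, j) * q j) = (\<Sum>j<nc. \<Sum>s\<in>S. vec_index s i * (c j s * q j))"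
      using c i by (intro sum.cong) (auto simp: sum_distrib_left algebra_simps)
    also have "\<dots> = (\<Sum>s\<in>S. \<Sum>j<nc. vec_index s i * (c j s * q j))" by (rule sum.swap)
    also have "\<dots> = (\<Sum>s\<in>S. vec_index s i * (\<Sum>j<nc. c j s * q j))" by (simp add: sum_distrib_left)
    also have "\<dots> = (\<Sum>l<mat_rank A. vec_index (e l) i * (\<Sum>j<nc. c j (e l) * q j))"
      by (rule sum.reindex_bij_betw[OF e, symmetric])
    also have "\<dots> = 0" using z by simp
    finally show "(\<Sum>j<nc. A $$ (i, j) * q j) = 0" .
  qed
qed

text \<open>With fewer conditions than independent columns, some nontrivial combination \<open>\<xi>\<close> of these columns
  would satisfy all conditions and hence vanish. The vector \<open>q\<close> carries the coefficients \<open>\<xi>\<close> to the positions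
  of the columns in \<open>A\<close>.\<close>

lemma mat_rank_le_card:
  fixes \<phi> :: "'k \<Rightarrow> nat \<Rightarrow> real"
  assumes A: "A \<in> carrier_mat nr nc" and "finite K"
    and ann: "\<And>q i. (\<And>k. k \<in> K \<Longrightarrow> (\<Sum>j<nc. \<phi> k j * q j) = 0) \<Longrightarrow> i < nr \<Longrightarrow>
       (\<Sum>j<nc. A $$ (i, j) * q j) = 0"
  shows "mat_rank A \<le> card K"
proof (rule ccontr)
  assume gt: "\<not> ?thesis"
  obtain S where S: "finite S" "S \<subseteq> set (cols A)" "card S = mat_rank A"
    "\<forall>c. (\<forall>i<nr. (\<Sum>s\<in>S. c s * vec_index s i) = 0) \<longrightarrow> (\<forall>s\<in>S. c s = 0)"
    "\<forall>j<nc. \<exists>c. \<forall>i<nr. A $$ (i, j) = (\<Sum>s\<in>S. c s * vec_index s i)"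
    by (rule column_basis[OF A])
  have "\<forall>s\<in>S. \<exists>j. j < nc \<and> s = col A j" using S(2) A by (fastforce simp: cols_def)
  then obtain g where g: "\<forall>s\<in>S. g s < nc \<and> s = col A (g s)"
    unfolding bchoice_iff by blast
  obtain \<xi> where \<xi>: "\<exists>s\<in>S. \<xi> s \<noteq> 0" and z: "\<And>k. k \<in> K \<Longrightarrow> (\<Sum>s\<in>S. \<phi> k (g s) * \<xi> s) = 0"
    using underdetermined_system[of K S "\<lambda>k s. \<phi> k (g s)"] gt S \<open>finite K\<close> by auto
  define q where "q j = (\<Sum>s\<in>S. if g s = j then \<xi> s else 0)" for j
  have expand: "(\<Sum>j<nc. f j * q j) = (\<Sum>s\<in>S. f (g s) * \<xi> s)" for f :: "nat \<Rightarrow> real"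
  proof -
    have "(\<Sum>j<nc. f j * q j) = (\<Sum>j<nc. \<Sum>s\<in>S. if g s = j then f j * \<xi> s else 0)"
      by (simp add: q_def sum_distrib_left if_distrib cong: if_cong)
    also have "\<dots> = (\<Sum>s\<in>S. \<Sum>j<nc. if g s = j then f j * \<xi> s else 0)" by (rule sum.swap)
    also have "\<dots> = (\<Sum>s\<in>S. f (g s) * \<xi> s)" using g by (intro sum.cong) auto
    finally show ?thesis .
  qed
  have "(\<Sum>s\<in>S. \<xi> s * vec_index s i) = 0" if i: "i < nr" for i
  proof -
    have "(\<Sum>j<nc. A $$ (i, j) * q j) = 0" using z i by (intro ann) (simp_all add: expand)
    then have "(\<Sum>s\<in>S. A $$ (i, g s) * \<xi> s) = 0" by (simp add: expand)
    also have "(\<Sum>s\<in>S. A $$ (i, g s) * \<xi> s) = (\<Sum>s\<in>S. \<xi> s * vec_index s i)"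
    proof (intro sum.cong refl)
      fix s assume "s \<in> S"
      then have gs: "g s < nc" "s = col A (g s)" using g by auto
      have "vec_index s i = A $$ (i, g s)" by (subst gs(2)) (use gs(1) A i in simp)
      then show "A $$ (i, g s) * \<xi> s = \<xi> s * vec_index s i" by simp
    qed
    finally show ?thesis .
  qed
  with S(4) \<xi> show False by blast
qed

section \<open>Completing a symmetric matrix with prescribed nullity\<close>

lemma sum_indicator_mult:
  fixes v :: "'i \<Rightarrow> real"
  assumes "finite I" "a \<in> I"
  shows "(\<Sum>b\<in>I. (if a = b then 1 else 0) * v b) = v a"
proof -
  have "(\<Sum>b\<in>I. (if a = b then 1 else 0) * v b) = (\<Sum>b\<in>I. if a = b then v b else 0)"
    by (intro sum.cong) auto
  then show ?thesis using assms by simp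
qed

lemma bform_identity:
  assumes "finite I"
  shows "bform I (\<lambda>a b. if a = b then 1 else 0) u v = (\<Sum>a\<in>I. u a * v a)"
  unfolding bform_mult_right using sum_indicator_mult[OF assms]
  by (intro sum.cong refl arg_cong2[where f = "(*)"])

lemma identity_pencil:
  assumes "finite I" "\<And>a b. a \<in> I \<Longrightarrow> b \<in> I \<Longrightarrow> B a b = B b a"
  shows "sym_pencil I (\<lambda>a b. if a = b then 1 else 0) B"
proof
  fix u :: "'a \<Rightarrow> real" assume "\<exists>a\<in>I. u a \<noteq> 0"
  then obtain a where a: "a \<in> I" "u a \<noteq> 0" by blast
  have "(\<Sum>a\<in>I. u a * u a) > 0"
    using a assms(1) by (intro sum_pos2[of I a]) (auto simp: zero_less_mult_iff)
  then show "bform I (\<lambda>a b. if a = b then 1 else 0) u u > 0"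
    using assms(1) by (simp add: bform_identity)
qed (use assms in auto)

lemma orthonormal_eigenbasis:
  fixes B :: "'i \<Rightarrow> 'i \<Rightarrow> real"
  assumes I: "finite I" and sym: "\<And>a b. a \<in> I \<Longrightarrow> b \<in> I \<Longrightarrow> B a b = B b a"
  obtains f :: "nat \<Rightarrow> 'i \<Rightarrow> real" and \<beta> where
    "\<forall>k<card I. \<forall>l<card I. (\<Sum>a\<in>I. f k a * f l a) = (if k = l then 1 else 0)"
    "\<forall>k<card I. \<forall>a\<in>I. (\<Sum>b\<in>I. B a b * f k b) = \<beta> k * f k a"
    "\<forall>u. \<forall>a\<in>I. u a = (\<Sum>k<card I. (\<Sum>b\<in>I. f k b * u b) * f k a)"
proof -
  let ?M = "\<lambda>a b. if a = b then 1 else 0 :: real"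
  interpret sym_pencil I ?M B by (rule identity_pencil[OF assms])
  have id: "bform I ?M u v = (\<Sum>a\<in>I. u a * v a)" for u v
    using I by (rule bform_identity)
  obtain f \<beta> where
    f: "\<And>k l. k < card I \<Longrightarrow> l < card I \<Longrightarrow> bform I ?M (f k) (f l) = (if k = l then 1 else 0)"
    "\<And>k a. k < card I \<Longrightarrow> a \<in> I \<Longrightarrow> (\<Sum>b\<in>I. B a b * f k b) = \<beta> k * (\<Sum>b\<in>I. ?M a b * f k b)"
    by (rule simultaneous_diagonalization) blast
  show ?thesis
  proof (rule that[of f \<beta>]; intro allI impI ballI)
    show "(\<Sum>a\<in>I. f k a * f l a) = (if k = l then 1 else 0)" if "k < card I" "l < card I" for k l
      using f(1)[OF that] by (simp add: id)
    show "(\<Sum>b\<in>I. B a b * f k b) = \<beta> k * f k a" if "k < card I" "a \<in> I" for k a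
      using f(2)[OF that] unfolding sum_indicator_mult[OF I that(2)] .
    show "u a = (\<Sum>k<card I. (\<Sum>b\<in>I. f k b * u b) * f k a)" if "a \<in> I" for u a
      using orthonormal_expansion[OF f(1) that, of u] by (simp add: id)
  qed
qed

text \<open>Let the symmetric matrix \<open>B\<close> have blocks \<open>H\<close> on \<open>I0 \<times> I0\<close> and \<open>h\<close> on \<open>I0 \<times> C\<close>; the corner
  \<open>C \<times> C\<close> may be chosen freely. Suppose that the block column of \<open>H\<close> and \<open>h\<^sup>T\<close> is injective. A kernel
  vector of a completion is then determined by its part \<open>c\<close> on \<open>C\<close>, and \<open>c\<close> is orthogonal to the
  space \<open>h\<^sup>T (ker H)\<close>, which has the dimension of \<open>ker H\<close>. So the nullity is at most
  \<open>card C - dim ker H\<close>, and the lemma shows that each \<open>m\<close> up to this bound occurs. The hypothesis on \<open>r\<close>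
  says that \<open>r \<le> rank H\<close>.

  With a pseudo-inverse \<open>G\<close> of \<open>H\<close>, the corner \<open>h\<^sup>T G h\<close> gives the maximal nullity: its kernel
  consists of the pairs \<open>(- G h c, c)\<close> with \<open>c\<close> orthogonal to \<open>h\<^sup>T (ker H)\<close>. Adding the orthogonal
  projection onto the complement of \<open>m\<close> orthonormal vectors of that kind cuts the kernel down to dimension \<open>m\<close>. The
  two eigenbases in the proof make this explicit: \<open>u\<close> diagonalizes \<open>H\<close>, so that \<open>G\<close> inverts
  the nonzero eigenvalues \<open>\<kappa>\<close>, and \<open>f\<close> diagonalizes \<open>F = h\<^sup>T E h\<close>, where \<open>E\<close> projects onto
  \<open>ker H\<close>, so that the orthogonal complement of \<open>h\<^sup>T (ker H)\<close> is spanned by the \<open>f l\<close> with \<open>F f l = 0\<close>.\<close>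

lemma completion_with_nullity:
  fixes B :: "'i \<Rightarrow> 'i \<Rightarrow> real" and m r :: nat
  assumes fin: "finite I0" "finite C" and disj: "I0 \<inter> C = {}"
    and sym: "\<And>a b. a \<in> I0 \<union> C \<Longrightarrow> b \<in> I0 \<union> C \<Longrightarrow> B a b = B b a"
    and inj: "\<And>q. (\<And>a. a \<in> I0 \<union> C \<Longrightarrow> (\<Sum>b\<in>I0. B a b * q b) = 0) \<Longrightarrow> \<forall>b\<in>I0. q b = 0"
    and rank: "\<And>(K :: nat set) \<phi>. finite K \<Longrightarrow>
       (\<And>q a. (\<And>k. k \<in> K \<Longrightarrow> (\<Sum>b\<in>I0. \<phi> k b * q b) = 0) \<Longrightarrow> a \<in> I0 \<Longrightarrow> (\<Sum>b\<in>I0. B a b * q b) = 0)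
       \<Longrightarrow> r \<le> card K"
    and m: "m + card I0 \<le> r + card C"
  obtains B' f P where
    "\<forall>a\<in>I0. \<forall>b. B' a b = B a b"
    "\<forall>a\<in>I0 \<union> C. \<forall>b\<in>I0 \<union> C. B' a b = B' b a"
    "\<forall>u. (\<forall>a\<in>I0 \<union> C. (\<Sum>b\<in>I0 \<union> C. B' a b * u b) = 0) \<longrightarrow>
       (\<forall>l<m. (\<Sum>c\<in>C. f l c * u c) = 0) \<longrightarrow> (\<forall>a\<in>I0 \<union> C. u a = 0)"
    "\<forall>l<m. \<forall>a\<in>I0 \<union> C. (\<Sum>b\<in>I0 \<union> C. B' a b * P l b) = 0"
    "\<forall>\<xi>. (\<forall>c\<in>C. (\<Sum>l<m. \<xi> l * P l c) = 0) \<longrightarrow> (\<forall>l<m. \<xi> l = 0)"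
proof -
  have I0_sym: "B a b = B b a" if "a \<in> I0" "b \<in> I0" for a b using sym that by simp
  obtain u \<kappa> where basis: "\<forall>k<card I0. \<forall>l<card I0. (\<Sum>a\<in>I0. u k a * u l a) = (if k = l then 1 else 0)"
    "\<forall>k<card I0. \<forall>a\<in>I0. (\<Sum>b\<in>I0. B a b * u k b) = \<kappa> k * u k a"
    "\<forall>w. \<forall>a\<in>I0. w a = (\<Sum>k<card I0. (\<Sum>b\<in>I0. u k b * w b) * u k a)"
    by (rule orthonormal_eigenbasis[OF fin(1) I0_sym])
  note u_orth = basis(1)[rule_format] and u_eig = basis(2)[rule_format] and u_exp = basis(3)[rule_format]
  define N where "N = {k. k < card I0 \<and> \<kappa> k = 0}"
  define R where "R = {k. k < card I0 \<and> \<kappa> k \<noteq> 0}"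
  have finNR: "finite N" "finite R" and NR: "N \<inter> R = {}" "N \<union> R = {..<card I0}"
    by (auto simp: N_def R_def)
  have cNR: "card N + card R = card I0" using card_Un_disjoint[OF finNR NR(1)] NR(2) by simp
  have u_selfadj: "(\<Sum>a\<in>I0. u k a * (\<Sum>b\<in>I0. B a b * v b)) = \<kappa> k * (\<Sum>b\<in>I0. u k b * v b)"
    if "k < card I0" for k v
  proof -
    have "(\<Sum>a\<in>I0. u k a * (\<Sum>b\<in>I0. B a b * v b)) = bform I0 B v (u k)"
      using bform_sym[of I0 B v "u k"] sym by (simp add: bform_mult_right)
    also have "\<dots> = (\<Sum>a\<in>I0. v a * (\<kappa> k * u k a))"
      using u_eig[OF that] by (simp add: bform_mult_right)
    finally show ?thesis by (simp add: sum_distrib_left algebra_simps)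
  qed
  \<comment> \<open>\<open>\<eta> k c\<close> is the component along \<open>u k\<close> of the column \<open>c\<close> of the off-diagonal block.\<close>
  define \<eta> where "\<eta> k c = (\<Sum>a\<in>I0. u k a * B a c)" for k c
  have "r \<le> card R"
  proof (rule rank[OF finNR(2), of u])
    fix q a assume z: "\<And>k. k \<in> R \<Longrightarrow> (\<Sum>b\<in>I0. u k b * q b) = 0" and a: "a \<in> I0"
    have "(\<Sum>b\<in>I0. B a b * q b) = (\<Sum>k<card I0. (\<Sum>b\<in>I0. u k b * (\<Sum>c\<in>I0. B b c * q c)) * u k a)"
      by (rule u_exp[OF a, of "\<lambda>a. \<Sum>b\<in>I0. B a b * q b"])
    also have "\<dots> = (\<Sum>k<card I0. (\<kappa> k * (\<Sum>b\<in>I0. u k b * q b)) * u k a)"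
      using u_selfadj by (intro sum.cong) auto
    also have "\<dots> = 0" using z by (intro sum.neutral) (auto simp: R_def)
    finally show "(\<Sum>b\<in>I0. B a b * q b) = 0" .
  qed
  then have mN: "m + card N \<le> card C" using m cNR by simp
  \<comment> \<open>The kernel of \<open>F\<close> is the orthogonal complement of \<open>h\<^sup>T (ker H)\<close>.\<close>
  define F where "F c d = (\<Sum>k\<in>N. \<eta> k c * \<eta> k d)" for c d
  have F_sym: "F a b = F b a" for a b by (simp add: F_def mult.commute)
  obtain f \<beta> where basis: "\<forall>k<card C. \<forall>l<card C. (\<Sum>a\<in>C. f k a * f l a) = (if k = l then 1 else 0)"
    "\<forall>k<card C. \<forall>a\<in>C. (\<Sum>b\<in>C. F a b * f k b) = \<beta> k * f k a"
    "\<forall>w. \<forall>a\<in>C. w a = (\<Sum>k<card C. (\<Sum>b\<in>C. f k b * w b) * f k a)"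
    by (rule orthonormal_eigenbasis[OF fin(2) F_sym])
  note f_orth = basis(1)[rule_format] and f_eig = basis(2)[rule_format] and f_exp = basis(3)[rule_format]
  define Y where "Y = {k. k < card C \<and> \<beta> k \<noteq> 0}"
  define Y0 where "Y0 = {k. k < card C \<and> \<beta> k = 0}"
  have finY: "finite Y" "finite Y0" "Y \<inter> Y0 = {}" "Y \<union> Y0 = {..<card C}" by (auto simp: Y_def Y0_def)
  have F_form: "(\<Sum>c\<in>C. \<Sum>d\<in>C. v c * F c d * w d) = (\<Sum>k\<in>N. (\<Sum>c\<in>C. \<eta> k c * v c) * (\<Sum>c\<in>C. \<eta> k c * w c))" for v w
  proof -
    have "(\<Sum>c\<in>C. \<Sum>d\<in>C. v c * F c d * w d) = (\<Sum>c\<in>C. \<Sum>d\<in>C. \<Sum>k\<in>N. \<eta> k c * v c * (\<eta> k d * w d))"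
      by (simp add: F_def sum_distrib_left sum_distrib_right algebra_simps)
    also have "\<dots> = (\<Sum>c\<in>C. \<Sum>k\<in>N. \<Sum>d\<in>C. \<eta> k c * v c * (\<eta> k d * w d))"
      by (intro sum.cong refl sum.swap)
    also have "\<dots> = (\<Sum>k\<in>N. \<Sum>c\<in>C. \<Sum>d\<in>C. \<eta> k c * v c * (\<eta> k d * w d))" by (rule sum.swap)
    finally show ?thesis by (simp add: sum_product)
  qed
  have F_eig_form: "(\<Sum>c\<in>C. \<Sum>d\<in>C. v c * F c d * f l d) = \<beta> l * (\<Sum>c\<in>C. v c * f l c)" if "l < card C" for v l
  proof -
    have "(\<Sum>c\<in>C. \<Sum>d\<in>C. v c * F c d * f l d) = (\<Sum>c\<in>C. v c * (\<Sum>d\<in>C. F c d * f l d))"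
      by (simp add: sum_distrib_left algebra_simps)
    also have "\<dots> = (\<Sum>c\<in>C. v c * (\<beta> l * f l c))" using f_eig[OF that] by simp
    finally show ?thesis by (simp add: sum_distrib_left algebra_simps)
  qed
  have "card Y \<le> card N"
  proof (rule ccontr)
    assume "\<not> ?thesis"
    then obtain \<xi> where \<xi>: "\<exists>l\<in>Y. \<xi> l \<noteq> 0" and z: "\<And>k. k \<in> N \<Longrightarrow> (\<Sum>l\<in>Y. (\<Sum>c\<in>C. \<eta> k c * f l c) * \<xi> l) = 0"
      using underdetermined_system[of N Y "\<lambda>k l. \<Sum>c\<in>C. \<eta> k c * f l c"] finNR finY by auto
    define v where "v c = (\<Sum>l\<in>Y. \<xi> l * f l c)" for c
    have "(\<Sum>c\<in>C. \<eta> k c * v c) = 0" if "k \<in> N" for k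
    proof -
      have "(\<Sum>c\<in>C. \<eta> k c * v c) = (\<Sum>c\<in>C. \<Sum>l\<in>Y. \<eta> k c * f l c * \<xi> l)"
        by (simp add: v_def sum_distrib_left algebra_simps)
      also have "\<dots> = (\<Sum>l\<in>Y. \<Sum>c\<in>C. \<eta> k c * f l c * \<xi> l)" by (rule sum.swap)
      also have "\<dots> = 0" using z[OF that] by (simp add: sum_distrib_right)
      finally show ?thesis .
    qed
    then have Fv: "(\<Sum>c\<in>C. \<Sum>d\<in>C. v c * F c d * w d) = 0" for w unfolding F_form by simp
    have "\<xi> l = 0" if l: "l \<in> Y" for l
    proof -
      have "(\<Sum>c\<in>C. v c * f l c) = (\<Sum>c\<in>C. \<Sum>j\<in>Y. \<xi> j * (f j c * f l c))"
        by (simp only: v_def sum_distrib_right mult.assoc)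
      also have "\<dots> = (\<Sum>j\<in>Y. \<Sum>c\<in>C. \<xi> j * (f j c * f l c))" by (rule sum.swap)
      also have "\<dots> = (\<Sum>j\<in>Y. \<xi> j * (\<Sum>c\<in>C. f j c * f l c))" by (simp add: sum_distrib_left)
      also have "\<dots> = (\<Sum>j\<in>Y. if j = l then \<xi> l else 0)"
        using l f_orth by (intro sum.cong) (auto simp: Y_def)
      also have "\<dots> = \<xi> l" using l finY by simp
      finally have "\<beta> l * \<xi> l = 0" using F_eig_form[of l v] Fv[of "f l"] l by (simp add: Y_def)
      then show ?thesis using l by (simp add: Y_def)
    qed
    then show False using \<xi> by blast
  qed
  then have "m \<le> card Y0" using mN card_Un_disjoint[OF finY(1-3)] finY(4) by simp
  then obtain e where e: "e ` {..<m} \<subseteq> Y0" "inj_on e {..<m}"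
    using card_le_inj[of "{..<m}" Y0] finY(2) by auto
  define G where "G = {..<card C} - e ` {..<m}"
  have eC: "e l < card C" if "l < m" for l using e(1) that by (auto simp: Y0_def)
  \<comment> \<open>The chosen vectors are orthogonal to \<open>h\<^sup>T (ker H)\<close>: the form \<open>F\<close> is a sum of squares.\<close>
  have \<eta>_e: "(\<Sum>c\<in>C. \<eta> k c * f (e l) c) = 0" if "l < m" "k \<in> N" for l k
  proof -
    have "\<beta> (e l) = 0" using e(1) that(1) by (auto simp: Y0_def)
    then have "(\<Sum>c\<in>C. \<Sum>d\<in>C. f (e l) c * F c d * f (e l) d) = 0" using F_eig_form[OF eC[OF that(1)]] by simp
    then have "(\<Sum>k\<in>N. (\<Sum>c\<in>C. \<eta> k c * f (e l) c) * (\<Sum>c\<in>C. \<eta> k c * f (e l) c)) = 0" unfolding F_form .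
    then show ?thesis using that(2) finNR(1) by (subst (asm) sum_nonneg_eq_0_iff) auto
  qed
  \<comment> \<open>The corner \<open>h\<^sup>T G h\<close> plus the projection onto the span of the vectors that were not chosen.\<close>
  define Z where "Z c d = (\<Sum>k\<in>R. \<eta> k c * \<eta> k d / \<kappa> k) + (\<Sum>l\<in>G. f l c * f l d)" for c d
  define B' where "B' a b = (if a \<in> I0 \<or> b \<in> I0 then B a b else Z a b)" for a b
  have split: "(\<Sum>b\<in>I0 \<union> C. g b) = (\<Sum>b\<in>I0. g b) + (\<Sum>b\<in>C. g b)" for g :: "'i \<Rightarrow> real"
    using fin disj by (rule sum.union_disjoint)
  have B'_I0: "(\<Sum>b\<in>I0 \<union> C. B' a b * v b) = (\<Sum>b\<in>I0. B a b * v b) + (\<Sum>c\<in>C. B a c * v c)" if "a \<in> I0" for a v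
    using that by (simp add: split B'_def)
  have B'_C: "(\<Sum>b\<in>I0 \<union> C. B' c b * v b) = (\<Sum>b\<in>I0. B c b * v b) + (\<Sum>d\<in>C. Z c d * v d)" if "c \<in> C" for c v
  proof -
    have "(\<Sum>b\<in>I0. B' c b * v b) = (\<Sum>b\<in>I0. B c b * v b)" by (intro sum.cong) (auto simp: B'_def)
    moreover have "(\<Sum>b\<in>C. B' c b * v b) = (\<Sum>b\<in>C. Z c b * v b)"
      using disj that by (intro sum.cong) (auto simp: B'_def)
    ultimately show ?thesis by (simp add: split)
  qed
  have Z_apply: "(\<Sum>d\<in>C. Z c d * v d)
      = (\<Sum>k\<in>R. \<eta> k c * (\<Sum>d\<in>C. \<eta> k d * v d) / \<kappa> k) + (\<Sum>l\<in>G. f l c * (\<Sum>d\<in>C. f l d * v d))" for c v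
  proof -
    have "(\<Sum>d\<in>C. Z c d * v d) = (\<Sum>d\<in>C. \<Sum>k\<in>R. \<eta> k c * (\<eta> k d * v d) / \<kappa> k)
        + (\<Sum>d\<in>C. \<Sum>l\<in>G. f l c * (f l d * v d))"
      by (simp add: Z_def sum.distrib sum_distrib_right distrib_right mult.assoc)
    also have "(\<Sum>d\<in>C. \<Sum>k\<in>R. \<eta> k c * (\<eta> k d * v d) / \<kappa> k) = (\<Sum>k\<in>R. \<Sum>d\<in>C. \<eta> k c * (\<eta> k d * v d) / \<kappa> k)"
      by (rule sum.swap)
    also have "(\<Sum>d\<in>C. \<Sum>l\<in>G. f l c * (f l d * v d)) = (\<Sum>l\<in>G. \<Sum>d\<in>C. f l c * (f l d * v d))"
      by (rule sum.swap)
    finally show ?thesis by (simp add: sum_distrib_left sum_divide_distrib)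
  qed
  have expand_col: "(\<Sum>b\<in>I0. B c b * v b) = (\<Sum>k<card I0. (\<Sum>b\<in>I0. u k b * v b) * \<eta> k c)" if "c \<in> C" for c v
  proof -
    have "(\<Sum>b\<in>I0. B c b * v b) = (\<Sum>b\<in>I0. B b c * (\<Sum>k<card I0. (\<Sum>a\<in>I0. u k a * v a) * u k b))"
      using sym that by (intro sum.cong refl arg_cong2[where f = "(*)"] u_exp) auto
    also have "\<dots> = (\<Sum>b\<in>I0. \<Sum>k<card I0. (\<Sum>a\<in>I0. u k a * v a) * (u k b * B b c))"
      by (simp add: sum_distrib_left algebra_simps)
    also have "\<dots> = (\<Sum>k<card I0. \<Sum>b\<in>I0. (\<Sum>a\<in>I0. u k a * v a) * (u k b * B b c))" by (rule sum.swap)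
    also have "\<dots> = (\<Sum>k<card I0. (\<Sum>b\<in>I0. u k b * v b) * \<eta> k c)"
      by (simp add: \<eta>_def sum_distrib_left)
    finally show ?thesis .
  qed
  have sumNR: "(\<Sum>k<card I0. g k) = (\<Sum>k\<in>N. g k) + (\<Sum>k\<in>R. g k)" for g :: "nat \<Rightarrow> real"
    using sum.union_disjoint[OF finNR NR(1)] NR(2) by simp
  have \<eta>_apply: "(\<Sum>a\<in>I0. u k a * (\<Sum>c\<in>C. B a c * v c)) = (\<Sum>c\<in>C. \<eta> k c * v c)" for k v
  proof -
    have "(\<Sum>a\<in>I0. u k a * (\<Sum>c\<in>C. B a c * v c)) = (\<Sum>a\<in>I0. \<Sum>c\<in>C. u k a * B a c * v c)"
      by (simp add: sum_distrib_left algebra_simps)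
    also have "\<dots> = (\<Sum>c\<in>C. \<Sum>a\<in>I0. u k a * B a c * v c)" by (rule sum.swap)
    finally show ?thesis by (simp add: \<eta>_def sum_distrib_right)
  qed
  have kernel: "\<forall>a\<in>I0 \<union> C. v a = 0"
    if ker: "\<And>a. a \<in> I0 \<union> C \<Longrightarrow> (\<Sum>b\<in>I0 \<union> C. B' a b * v b) = 0"
      and ann: "\<And>l. l < m \<Longrightarrow> (\<Sum>c\<in>C. f (e l) c * v c) = 0" for v
  proof -
    define \<alpha> where "\<alpha> k = (\<Sum>b\<in>I0. u k b * v b)" for k
    define h where "h k = (\<Sum>c\<in>C. \<eta> k c * v c)" for k
    have 1: "\<kappa> k * \<alpha> k + h k = 0" if "k < card I0" for k
    proof -
      have "(\<Sum>a\<in>I0. u k a * ((\<Sum>b\<in>I0. B a b * v b) + (\<Sum>c\<in>C. B a c * v c))) = 0"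
        using ker B'_I0[of _ v] by (intro sum.neutral ballI) (metis UnI1 mult_zero_right)
      then show ?thesis using u_selfadj[OF that, of v] \<eta>_apply[of k v]
        by (simp add: distrib_left sum.distrib \<alpha>_def h_def)
    qed
    have hN: "h k = 0" if "k \<in> N" for k using 1[of k] that by (auto simp: N_def)
    have hR: "\<alpha> k * \<eta> k c + \<eta> k c * h k / \<kappa> k = 0" if "k \<in> R" for k c
    proof -
      have "h k = - \<kappa> k * \<alpha> k" using 1[of k] that by (simp add: R_def)
      then show ?thesis using that by (simp add: R_def)
    qed
    have 2: "(\<Sum>k\<in>N. \<alpha> k * \<eta> k c) + (\<Sum>l\<in>G. f l c * (\<Sum>d\<in>C. f l d * v d)) = 0" if "c \<in> C" for c
    proof -
      have "(\<Sum>k<card I0. \<alpha> k * \<eta> k c) + (\<Sum>k\<in>R. \<eta> k c * h k / \<kappa> k) + (\<Sum>l\<in>G. f l c * (\<Sum>d\<in>C. f l d * v d)) = 0"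
        using ker[of c] that B'_C[OF that, of v] by (simp add: Z_apply expand_col \<alpha>_def h_def)
      moreover have "(\<Sum>k\<in>R. \<alpha> k * \<eta> k c) + (\<Sum>k\<in>R. \<eta> k c * h k / \<kappa> k) = 0"
        using hR by (simp add: sum.distrib[symmetric])
      ultimately show ?thesis by (simp add: sumNR)
    qed
    \<comment> \<open>Pairing with \<open>v\<close> itself leaves only a sum of squares.\<close>
    have "(\<Sum>c\<in>C. v c * ((\<Sum>k\<in>N. \<alpha> k * \<eta> k c) + (\<Sum>l\<in>G. f l c * (\<Sum>d\<in>C. f l d * v d)))) = 0"
      using 2 by (intro sum.neutral) auto
    moreover have "(\<Sum>c\<in>C. v c * (\<Sum>k\<in>N. \<alpha> k * \<eta> k c)) = (\<Sum>k\<in>N. \<alpha> k * h k)"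
    proof -
      have "(\<Sum>c\<in>C. v c * (\<Sum>k\<in>N. \<alpha> k * \<eta> k c)) = (\<Sum>c\<in>C. \<Sum>k\<in>N. \<alpha> k * (\<eta> k c * v c))"
        unfolding sum_distrib_left by (intro sum.cong refl) (simp add: mult_ac)
      also have "\<dots> = (\<Sum>k\<in>N. \<Sum>c\<in>C. \<alpha> k * (\<eta> k c * v c))" by (rule sum.swap)
      finally show ?thesis unfolding h_def sum_distrib_left .
    qed
    moreover have "(\<Sum>c\<in>C. v c * (\<Sum>l\<in>G. f l c * (\<Sum>d\<in>C. f l d * v d)))
        = (\<Sum>l\<in>G. (\<Sum>d\<in>C. f l d * v d) * (\<Sum>d\<in>C. f l d * v d))"
    proof -
      have "(\<Sum>c\<in>C. v c * (\<Sum>l\<in>G. f l c * (\<Sum>d\<in>C. f l d * v d)))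
          = (\<Sum>c\<in>C. \<Sum>l\<in>G. (f l c * v c) * (\<Sum>d\<in>C. f l d * v d))"
        unfolding sum_distrib_left[of "v _"] by (intro sum.cong refl) (simp add: mult_ac)
      also have "\<dots> = (\<Sum>l\<in>G. \<Sum>c\<in>C. (f l c * v c) * (\<Sum>d\<in>C. f l d * v d))" by (rule sum.swap)
      finally show ?thesis unfolding sum_distrib_right .
    qed
    ultimately have "(\<Sum>k\<in>N. \<alpha> k * h k) + (\<Sum>l\<in>G. (\<Sum>d\<in>C. f l d * v d) * (\<Sum>d\<in>C. f l d * v d)) = 0"
      by (simp only: distrib_left sum.distrib)
    then have "(\<Sum>l\<in>G. (\<Sum>d\<in>C. f l d * v d) * (\<Sum>d\<in>C. f l d * v d)) = 0" using hN by simp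
    then have "(\<Sum>d\<in>C. f l d * v d) = 0" if "l \<in> G" for l
      using that by (subst (asm) sum_nonneg_eq_0_iff) (auto simp: G_def)
    then have "(\<Sum>d\<in>C. f l d * v d) = 0" if "l < card C" for l
      using that ann by (cases "l \<in> G") (auto simp: G_def)
    then have vC: "v c = 0" if "c \<in> C" for c using f_exp[OF that, of v] by simp
    have "\<forall>b\<in>I0. v b = 0"
    proof (rule inj)
      fix a assume "a \<in> I0 \<union> C"
      then show "(\<Sum>b\<in>I0. B a b * v b) = 0"
        using ker[of a] B'_I0[of a v] B'_C[of a v] vC by auto
    qed
    with vC show ?thesis by blast
  qed
  define z where "z l k = (\<Sum>c\<in>C. \<eta> k c * f (e l) c) / \<kappa> k" for l k
  define P where "P l a = (if a \<in> C then f (e l) a else - (\<Sum>k\<in>R. z l k * u k a))" for l a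
  have P_C: "(\<Sum>c\<in>C. g c * P l c) = (\<Sum>c\<in>C. g c * f (e l) c)" for g l by (simp add: P_def)
  have P_u: "(\<Sum>b\<in>I0. u k b * P l b) = (if k \<in> R then - z l k else 0)" if "k < card I0" for k l
  proof -
    have "(\<Sum>b\<in>I0. u k b * P l b) = - (\<Sum>b\<in>I0. \<Sum>j\<in>R. z l j * (u k b * u j b))"
      unfolding sum_negf[symmetric] using disj by (intro sum.cong) (auto simp: P_def sum_distrib_left sum_negf mult_ac)
    also have "(\<Sum>b\<in>I0. \<Sum>j\<in>R. z l j * (u k b * u j b)) = (\<Sum>j\<in>R. z l j * (\<Sum>b\<in>I0. u k b * u j b))"
      by (subst sum.swap) (simp add: sum_distrib_left)
    also have "\<dots> = (\<Sum>j\<in>R. if j = k then z l k else 0)"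
      using u_orth that by (intro sum.cong) (auto simp: R_def)
    finally show ?thesis using finNR by simp
  qed
  show ?thesis
  proof (rule that[of B' "\<lambda>l. f (e l)" P]; intro allI impI ballI)
    show "B' a b = B a b" if "a \<in> I0" for a b using that by (simp add: B'_def)
    show "B' a b = B' b a" if "a \<in> I0 \<union> C" "b \<in> I0 \<union> C" for a b
      using sym[OF that] by (simp add: B'_def Z_def mult.commute)
    show "v a = 0" if "\<forall>a\<in>I0 \<union> C. (\<Sum>b\<in>I0 \<union> C. B' a b * v b) = 0"
      "\<forall>l<m. (\<Sum>c\<in>C. f (e l) c * v c) = 0" "a \<in> I0 \<union> C" for v a
      using kernel[of v] that by blast
    show "(\<Sum>b\<in>I0 \<union> C. B' a b * P l b) = 0" if l: "l < m" and a: "a \<in> I0 \<union> C" for l a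
    proof (cases "a \<in> I0")
      case True
      have "(\<Sum>b\<in>I0 \<union> C. B' a b * P l b)
          = (\<Sum>k<card I0. (\<Sum>b\<in>I0. u k b * (\<Sum>c\<in>I0 \<union> C. B' b c * P l c)) * u k a)"
        by (rule u_exp[OF True, of "\<lambda>a. \<Sum>b\<in>I0 \<union> C. B' a b * P l b"])
      also have "\<dots> = (\<Sum>k<card I0. (\<kappa> k * (\<Sum>b\<in>I0. u k b * P l b) + (\<Sum>c\<in>C. \<eta> k c * f (e l) c)) * u k a)"
      proof (intro sum.cong refl arg_cong2[where f = "(*)"])
        fix k assume k: "k \<in> {..<card I0}"
        have "(\<Sum>b\<in>I0. u k b * (\<Sum>c\<in>I0 \<union> C. B' b c * P l c))
            = (\<Sum>b\<in>I0. u k b * ((\<Sum>c\<in>I0. B b c * P l c) + (\<Sum>c\<in>C. B b c * f (e l) c)))"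
          by (intro sum.cong refl) (simp add: B'_I0 P_C)
        also have "\<dots> = \<kappa> k * (\<Sum>b\<in>I0. u k b * P l b) + (\<Sum>c\<in>C. \<eta> k c * f (e l) c)"
          using k by (simp add: distrib_left sum.distrib u_selfadj \<eta>_apply)
        finally show "(\<Sum>b\<in>I0. u k b * (\<Sum>c\<in>I0 \<union> C. B' b c * P l c))
            = \<kappa> k * (\<Sum>b\<in>I0. u k b * P l b) + (\<Sum>c\<in>C. \<eta> k c * f (e l) c)" .
      qed
      also have "\<dots> = 0"
      proof (intro sum.neutral ballI)
        fix k assume k: "k \<in> {..<card I0}"
        show "(\<kappa> k * (\<Sum>b\<in>I0. u k b * P l b) + (\<Sum>c\<in>C. \<eta> k c * f (e l) c)) * u k a = 0"
        proof (cases "k \<in> R")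
          case True
          then show ?thesis using k P_u[of k l] by (simp add: R_def z_def)
        next
          case False
          then have "k \<in> N" using k by (auto simp: N_def R_def)
          then show ?thesis using \<eta>_e[OF l] by (simp add: N_def)
        qed
      qed
      finally show ?thesis .
    next
      case False
      then have c: "a \<in> C" using a by blast
      have "(\<Sum>l'\<in>G. f l' a * (\<Sum>d\<in>C. f l' d * f (e l) d)) = 0"
        using f_orth eC[OF l] l by (intro sum.neutral) (auto simp: G_def)
      moreover have "(\<Sum>k<card I0. (\<Sum>b\<in>I0. u k b * P l b) * \<eta> k a) + (\<Sum>k\<in>R. \<eta> k a * (\<Sum>d\<in>C. \<eta> k d * f (e l) d) / \<kappa> k) = 0"
      proof -
        have "(\<Sum>k\<in>N. (\<Sum>b\<in>I0. u k b * P l b) * \<eta> k a) = 0"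
          using P_u by (intro sum.neutral) (auto simp: N_def R_def)
        moreover have "(\<Sum>k\<in>R. (\<Sum>b\<in>I0. u k b * P l b) * \<eta> k a) = (\<Sum>k\<in>R. - (\<eta> k a * (\<Sum>d\<in>C. \<eta> k d * f (e l) d) / \<kappa> k))"
          using P_u by (intro sum.cong) (auto simp: R_def z_def)
        ultimately show ?thesis by (simp add: sumNR sum_negf)
      qed
      ultimately show ?thesis by (simp add: B'_C[OF c] Z_apply expand_col[OF c] P_C)
    qed
    show "\<xi> j = 0" if z: "\<forall>c\<in>C. (\<Sum>l<m. \<xi> l * P l c) = 0" and j: "j < m" for \<xi> j
    proof -
      have "(\<Sum>c\<in>C. f (e j) c * (\<Sum>l<m. \<xi> l * f (e l) c)) = 0"
        using z by (intro sum.neutral) (auto simp: P_def)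
      moreover have "(\<Sum>c\<in>C. f (e j) c * (\<Sum>l<m. \<xi> l * f (e l) c)) = (\<Sum>c\<in>C. \<Sum>l<m. \<xi> l * (f (e j) c * f (e l) c))"
        by (simp add: sum_distrib_left algebra_simps)
      moreover have "\<dots> = (\<Sum>l<m. \<Sum>c\<in>C. \<xi> l * (f (e j) c * f (e l) c))" by (rule sum.swap)
      moreover have "\<dots> = (\<Sum>l<m. \<xi> l * (\<Sum>c\<in>C. f (e j) c * f (e l) c))" by (simp add: sum_distrib_left)
      moreover have "\<dots> = (\<Sum>l<m. if l = j then \<xi> j else 0)"
        using j f_orth eC inj_onD[OF e(2)] by (intro sum.cong) auto
      ultimately show "\<xi> j = 0" using j by simp
    qed
  qed
qed

section \<open>Positive semidefinite matrices\<close>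

lemma quadratic_form_entries:
  assumes "A \<in> carrier_mat k k"
  shows "scalar_prod (Matrix.vec k v) (A *\<^sub>v Matrix.vec k v) = bform {..<k} (\<lambda>c d. A $$ (c, d)) v v"
  using assms unfolding bform_mult_right scalar_prod_def
  by (intro sum.cong) (auto simp: scalar_prod_def atLeast0LessThan)

lemma sym_mats_iff:
  "A \<in> sym_mats k \<longleftrightarrow> A \<in> carrier_mat k k \<and> (\<forall>c<k. \<forall>d<k. A $$ (c, d) = A $$ (d, c))"
proof (intro iffI conjI)
  assume A: "A \<in> carrier_mat k k \<and> (\<forall>c<k. \<forall>d<k. A $$ (c, d) = A $$ (d, c))"
  then have "transpose_mat A = A" by (intro eq_matI) auto
  then show "A \<in> sym_mats k" using A by (simp add: sym_mats_def)
next
  assume "A \<in> sym_mats k"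
  then have c: "A \<in> carrier_mat k k" and t: "transpose_mat A = A" by (auto simp: sym_mats_def)
  show "A \<in> carrier_mat k k" by (fact c)
  show "\<forall>c<k. \<forall>d<k. A $$ (c, d) = A $$ (d, c)"
  proof (intro allI impI)
    fix i j assume "i < k" "j < k"
    then have "transpose_mat A $$ (i, j) = A $$ (j, i)" using c by simp
    then show "A $$ (i, j) = A $$ (j, i)" unfolding t .
  qed
qed

lemma pos_semidef_iff:
  "pos_semidef k A \<longleftrightarrow> A \<in> carrier_mat k k \<and> (\<forall>c<k. \<forall>d<k. A $$ (c, d) = A $$ (d, c)) \<and>
     (\<forall>v. bform {..<k} (\<lambda>c d. A $$ (c, d)) v v \<ge> 0)"
proof -
  have "(\<forall>v\<in>carrier_vec k. scalar_prod v (A *\<^sub>v v) \<ge> 0) \<longleftrightarrow> (\<forall>v. bform {..<k} (\<lambda>c d. A $$ (c, d)) v v \<ge> 0)"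
    if A: "A \<in> carrier_mat k k"
  proof (intro iffI allI ballI)
    fix v assume "\<forall>v\<in>carrier_vec k. scalar_prod v (A *\<^sub>v v) \<ge> 0"
    then show "bform {..<k} (\<lambda>c d. A $$ (c, d)) v v \<ge> 0"
      using quadratic_form_entries[OF A, of v] by (metis vec_carrier)
  next
    fix v :: "real Matrix.vec"
    assume nn: "\<forall>v. bform {..<k} (\<lambda>c d. A $$ (c, d)) v v \<ge> 0" and v: "v \<in> carrier_vec k"
    have "v = Matrix.vec k (vec_index v)" using v by (intro eq_vecI) auto
    then show "scalar_prod v (A *\<^sub>v v) \<ge> 0"
      using quadratic_form_entries[OF A, of "vec_index v"] nn by simp
  qed
  then show ?thesis unfolding pos_semidef_def sym_mats_iff by blast
qed

lemma pos_def_imp_bform: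
  assumes "pos_def k A" "\<exists>a<k. v a \<noteq> 0"
  shows "bform {..<k} (\<lambda>c d. A $$ (c, d)) v v > 0"
proof -
  have A: "A \<in> carrier_mat k k" using assms(1) by (simp add: pos_def_def sym_mats_iff)
  obtain a where "a < k" "v a \<noteq> 0" using assms(2) by blast
  then have "Matrix.vec k v \<noteq> 0\<^sub>v k" by (metis index_vec index_zero_vec(1))
  then have "scalar_prod (Matrix.vec k v) (A *\<^sub>v Matrix.vec k v) > 0"
    using assms(1) vec_carrier[of k v] unfolding pos_def_def by blast
  then show ?thesis unfolding quadratic_form_entries[OF A] .
qed

lemma psd_diag_nonneg:
  assumes "pos_semidef k A" "i < k"
  shows "A $$ (i, i) \<ge> 0"
proof -
  have "bform {..<k} (\<lambda>c d. A $$ (c, d)) (\<lambda>c. if i = c then 1 else 0) (\<lambda>c. if i = c then 1 else 0) \<ge> 0"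
    using assms(1) by (simp add: pos_semidef_iff)
  moreover have "bform {..<k} (\<lambda>c d. A $$ (c, d)) (\<lambda>c. if i = c then 1 else 0) (\<lambda>c. if i = c then 1 else 0) = A $$ (i, i)"
    unfolding bform_mult_right using assms(2)
    by (simp add: sum_indicator_mult mult.commute[of _ "if _ then _ else _"])
  ultimately show ?thesis by simp
qed

section \<open>Finitely atomic matrix measures\<close>

text \<open>The measure \<open>\<Sum>x\<in>X. b x \<delta>\<^sub>x\<close> on the Borel sets.\<close>

definition weighted_points :: "real set \<Rightarrow> (real \<Rightarrow> real) \<Rightarrow> real measure" where
  "weighted_points X b = distr (density (count_space X) (\<lambda>x. ennreal (b x))) borel (\<lambda>x. x)"

lemma weighted_points_space [simp]:
  "space (weighted_points X b) = UNIV" "sets (weighted_points X b) = sets borel"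
  by (simp_all add: weighted_points_def)

lemma emeasure_weighted_points:
  assumes X: "finite X" and b: "\<And>x. x \<in> X \<Longrightarrow> b x \<ge> 0" and \<Delta>: "\<Delta> \<in> sets borel"
  shows "emeasure (weighted_points X b) \<Delta> = ennreal (\<Sum>x\<in>X. b x * indicator \<Delta> x)"
proof -
  have "emeasure (weighted_points X b) \<Delta> = emeasure (density (count_space X) (\<lambda>x. ennreal (b x))) (\<Delta> \<inter> X)"
    unfolding weighted_points_def using \<Delta> by (subst emeasure_distr) auto
  also have "\<dots> = (\<Sum>x\<in>X. ennreal (b x) * indicator (\<Delta> \<inter> X) x)"
    using X by (subst emeasure_density) (auto simp: nn_integral_count_space_finite)
  also have "\<dots> = (\<Sum>x\<in>X. ennreal (b x * indicator \<Delta> x))"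
    by (intro sum.cong) (auto simp: indicator_def)
  also have "\<dots> = ennreal (\<Sum>x\<in>X. b x * indicator \<Delta> x)"
    using b by (intro sum_ennreal) auto
  finally show ?thesis .
qed

lemma measure_of_weighted_points:
  assumes "finite X" "\<And>x. x \<in> X \<Longrightarrow> b x \<ge> 0"
    and F: "\<And>\<Delta>. \<Delta> \<in> sets borel \<Longrightarrow> F \<Delta> = ennreal (\<Sum>x\<in>X. b x * indicator \<Delta> x)"
  shows "measure_of UNIV (sets borel) F = weighted_points X b"
proof -
  have "measure_of UNIV (sets borel) F = measure_of UNIV (sets borel) (emeasure (weighted_points X b))"
  proof (rule measure_of_eq)
    fix \<Delta> :: "real set" assume "\<Delta> \<in> sigma_sets UNIV (sets borel)"
    then have "\<Delta> \<in> sets borel" using sets.sigma_sets_eq[of "borel :: real measure"] by simp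
    then show "F \<Delta> = emeasure (weighted_points X b) \<Delta>"
      using F emeasure_weighted_points[OF assms(1,2)] by simp
  qed simp
  also have "\<dots> = weighted_points X b"
    using measure_of_of_measure[of "weighted_points X b"] by simp
  finally show ?thesis .
qed

lemma integral_weighted_points:
  assumes X: "finite X" and b: "\<And>x. x \<in> X \<Longrightarrow> b x \<ge> 0" and f: "f \<in> borel_measurable borel"
  shows "integrable (weighted_points X b) f" (is ?A)
    and "integral\<^sup>L (weighted_points X b) f = (\<Sum>x\<in>X. b x * f x)" (is ?B)
proof -
  have AE: "AE x in count_space X. 0 \<le> b x" using b by (simp add: AE_count_space)
  show ?A unfolding weighted_points_def using f X AE
    by (subst integrable_distr_eq) (auto simp: integrable_density integrable_count_space)
  show ?B unfolding weighted_points_def using f X AE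
    by (subst integral_distr) (auto simp: integral_density lebesgue_integral_count_space_finite)
qed

text \<open>The supremum is attained at the set of those points of \<open>\<Delta>\<close> that carry positive weight; it is
  finite, hence Borel.\<close>

lemma pos_variation_atomic:
  assumes X: "finite X" and \<nu>: "\<And>\<Delta>. \<Delta> \<in> sets borel \<Longrightarrow> \<nu> \<Delta> = (\<Sum>x\<in>X. a x * indicator \<Delta> x)"
  shows "pos_variation \<nu> = weighted_points X (\<lambda>x. max 0 (a x))"
  unfolding pos_variation_def
proof (rule measure_of_weighted_points)
  fix \<Delta> :: "real set" assume \<Delta>: "\<Delta> \<in> sets borel"
  show "(SUP B\<in>{B \<in> sets borel. B \<subseteq> \<Delta>}. ennreal (\<nu> B)) = ennreal (\<Sum>x\<in>X. max 0 (a x) * indicator \<Delta> x)"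
  proof (rule antisym)
    show "(SUP B\<in>{B \<in> sets borel. B \<subseteq> \<Delta>}. ennreal (\<nu> B)) \<le> ennreal (\<Sum>x\<in>X. max 0 (a x) * indicator \<Delta> x)"
    proof (rule SUP_least)
      fix B assume "B \<in> {B \<in> sets borel. B \<subseteq> \<Delta>}"
      then show "ennreal (\<nu> B) \<le> ennreal (\<Sum>x\<in>X. max 0 (a x) * indicator \<Delta> x)"
        using \<nu> by (auto intro!: ennreal_leI sum_mono simp: indicator_def)
    qed
    let ?B = "{x \<in> X. x \<in> \<Delta> \<and> a x > 0}"
    have "?B \<in> sets borel" using X by (intro borel_closed finite_imp_closed) simp
    moreover from this have "\<nu> ?B = (\<Sum>x\<in>X. max 0 (a x) * indicator \<Delta> x)"
      using \<nu> by (auto intro!: sum.cong simp: indicator_def)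
    ultimately show "ennreal (\<Sum>x\<in>X. max 0 (a x) * indicator \<Delta> x) \<le> (SUP B\<in>{B \<in> sets borel. B \<subseteq> \<Delta>}. ennreal (\<nu> B))"
      by (intro SUP_upper2[of ?B]) auto
  qed
qed (use X in auto)

lemma signed_integral_atomic:
  assumes X: "finite X" and \<nu>: "\<And>\<Delta>. \<Delta> \<in> sets borel \<Longrightarrow> \<nu> \<Delta> = (\<Sum>x\<in>X. a x * indicator \<Delta> x)"
    and f: "f \<in> borel_measurable borel"
  shows "signed_integral \<nu> f = (\<Sum>x\<in>X. a x * f x)"
proof -
  have pos: "pos_variation \<nu> = weighted_points X (\<lambda>x. max 0 (a x))"
    using X by (rule pos_variation_atomic) (rule \<nu>)
  have "pos_variation (\<lambda>B. - \<nu> B) = weighted_points X (\<lambda>x. max 0 (- a x))"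
    using X by (rule pos_variation_atomic) (simp add: \<nu> sum_negf)
  then have "signed_integral \<nu> f = (\<Sum>x\<in>X. max 0 (a x) * f x) - (\<Sum>x\<in>X. max 0 (- a x) * f x)"
    unfolding signed_integral_def pos
    by (simp add: integral_weighted_points[OF X _ f])
  also have "\<dots> = (\<Sum>x\<in>X. a x * f x)"
    unfolding sum_subtractf[symmetric] by (intro sum.cong) (auto simp: max_def algebra_simps)
  finally show ?thesis .
qed

lemma linear_op_coeffs:
  assumes L: "linear_op p N L" and q: "degree q \<le> N" and cd: "c < p" "d < p"
  shows "L q $$ (c, d) = (\<Sum>i\<le>N. Polynomial.coeff q i * moment L i $$ (c, d))"
proof -
  have dims: "L r \<in> carrier_mat p p" if "degree r \<le> N" for r
    using L that by (simp add: linear_op_def sym_mats_iff)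
  have smult: "L (Polynomial.smult x r) $$ (c, d) = x * L r $$ (c, d)" if "degree r \<le> N" for x r
    using L that cd dims[OF that] by (simp add: linear_op_def)
  have mon: "L (Polynomial.monom x i) $$ (c, d) = x * moment L i $$ (c, d)" if "i \<le> N" for x i
    using smult[of "Polynomial.monom 1 i" x] that by (simp add: moment_def smult_monom degree_monom_eq)
  have zero: "L 0 $$ (c, d) = 0" using smult[of 0 0] by simp
  have "L (\<Sum>i<k. Polynomial.monom (Polynomial.coeff q i) i) $$ (c, d)
      = (\<Sum>i<k. Polynomial.coeff q i * moment L i $$ (c, d))" if "k \<le> Suc N" for k
    using that
  proof (induction k)
    case 0
    then show ?case by (simp add: zero)
  next
    case (Suc k)
    have d1: "degree (\<Sum>i<k. Polynomial.monom (Polynomial.coeff q i) i) \<le> N"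
      using Suc.prems by (intro degree_sum_le) (auto intro: order_trans[OF degree_monom_le])
    have d2: "degree (Polynomial.monom (Polynomial.coeff q k) k) \<le> N"
      using Suc.prems by (auto intro: order_trans[OF degree_monom_le])
    have "L ((\<Sum>i<k. Polynomial.monom (Polynomial.coeff q i) i) + Polynomial.monom (Polynomial.coeff q k) k)
        = L (\<Sum>i<k. Polynomial.monom (Polynomial.coeff q i) i) + L (Polynomial.monom (Polynomial.coeff q k) k)"
      using L d1 d2 by (simp add: linear_op_def)
    then show ?case using Suc dims[OF d1] dims[OF d2] cd mon by simp
  qed
  from this[of "Suc N"] show ?thesis
    using poly_as_sum_of_monoms'[OF q] by (simp add: lessThan_Suc_atMost)
qed

lemma borel_measurable_poly: "poly q \<in> borel_measurable (borel :: real measure)"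
  by (intro borel_measurable_continuous_onI continuous_intros)

lemma atomic_form_pos_matrix_measure:
  assumes at: "atomic_form p \<mu> X A"
  shows "pos_matrix_measure p \<mu>"
  unfolding pos_matrix_measure_def
proof (intro conjI ballI allI impI)
  have X: "finite X" and A: "\<And>x. x \<in> X \<Longrightarrow> pos_semidef p (A x)"
    and \<mu>: "\<And>\<Delta>. \<Delta> \<in> sets borel \<Longrightarrow> \<mu> \<Delta> = mat p p (\<lambda>(i, j). \<Sum>x\<in>X. A x $$ (i, j) * indicator \<Delta> x)"
    using at by (auto simp: atomic_form_def)
  show "pos_semidef p (\<mu> \<Delta>)" if \<Delta>: "\<Delta> \<in> sets borel" for \<Delta>
    unfolding pos_semidef_iff
  proof (intro conjI allI impI)
    show "\<mu> \<Delta> \<in> carrier_mat p p" by (simp add: \<mu>[OF \<Delta>])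
    show "\<mu> \<Delta> $$ (c, d) = \<mu> \<Delta> $$ (d, c)" if "c < p" "d < p" for c d
      using that A by (auto simp: \<mu>[OF \<Delta>] pos_semidef_iff intro!: sum.cong)
    fix v
    have "bform {..<p} (\<lambda>c d. \<mu> \<Delta> $$ (c, d)) v v
        = (\<Sum>c<p. \<Sum>d<p. \<Sum>x\<in>X. indicator \<Delta> x * (v c * A x $$ (c, d) * v d))"
      unfolding bform_def
      by (intro sum.cong refl) (simp add: \<mu>[OF \<Delta>] sum_distrib_left sum_distrib_right mult_ac)
    also have "\<dots> = (\<Sum>c<p. \<Sum>x\<in>X. \<Sum>d<p. indicator \<Delta> x * (v c * A x $$ (c, d) * v d))"
      by (intro sum.cong refl sum.swap)
    also have "\<dots> = (\<Sum>x\<in>X. \<Sum>c<p. \<Sum>d<p. indicator \<Delta> x * (v c * A x $$ (c, d) * v d))"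
      by (rule sum.swap)
    also have "\<dots> = (\<Sum>x\<in>X. indicator \<Delta> x * bform {..<p} (\<lambda>c d. A x $$ (c, d)) v v)"
      by (simp add: bform_def sum_distrib_left)
    also have "\<dots> \<ge> 0" using A by (intro sum_nonneg mult_nonneg_nonneg) (auto simp: pos_semidef_iff)
    finally show "bform {..<p} (\<lambda>c d. \<mu> \<Delta> $$ (c, d)) v v \<ge> 0" .
  qed
  show "signed_measure (\<lambda>\<Delta>. \<mu> \<Delta> $$ (i, j))" if "i < p" "j < p" for i j
    unfolding signed_measure_def
  proof (intro conjI allI impI)
    show "\<mu> {} $$ (i, j) = 0" using that by (simp add: \<mu>)
    fix E :: "nat \<Rightarrow> real set"
    assume E: "range E \<subseteq> sets borel" "disjoint_family E"
    have "(\<lambda>k. \<Sum>x\<in>X. A x $$ (i, j) * indicator (E k) x) sums (\<Sum>x\<in>X. A x $$ (i, j) * indicator (\<Union>k. E k) x)"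
      using E(2) by (intro sums_sum sums_mult indicator_sums) (auto simp: disjoint_family_on_def)
    moreover have "E k \<in> sets borel" for k using E(1) by blast
    moreover from this have "(\<Union>k. E k) \<in> sets borel" by blast
    ultimately show "(\<lambda>k. \<mu> (E k) $$ (i, j)) sums \<mu> (\<Union>k. E k) $$ (i, j)" using that by (simp add: \<mu>)
  qed
qed

text \<open>For finitely atomic measures all integrals are finite sums, and by linearity it suffices to compare
  moments. This removes measure theory from the rest of the proof.\<close>

lemma representing_measure_atomic_iff:
  assumes L: "linear_op p (2 * n) L" and at: "atomic_form p \<mu> X A"
  shows "representing_measure p n L \<mu> \<longleftrightarrow>
    (\<forall>k\<le>2 * n. \<forall>c<p. \<forall>d<p. moment L k $$ (c, d) = (\<Sum>x\<in>X. x ^ k * A x $$ (c, d)))"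
proof -
  have X: "finite X" and A: "\<And>x. x \<in> X \<Longrightarrow> pos_semidef p (A x)"
    and \<mu>: "\<And>\<Delta>. \<Delta> \<in> sets borel \<Longrightarrow> \<mu> \<Delta> = mat p p (\<lambda>(i, j). \<Sum>x\<in>X. A x $$ (i, j) * indicator \<Delta> x)"
    using at by (auto simp: atomic_form_def)
  have int: "matrix_integral p \<mu> (poly q) $$ (c, d) = (\<Sum>x\<in>X. A x $$ (c, d) * poly q x)"
    if "c < p" "d < p" for q c d
    using that by (simp add: matrix_integral_def \<mu> signed_integral_atomic[OF X _ borel_measurable_poly])
  have tr: "integrable (trace_measure p \<mu>) (poly q)" for q
  proof -
    have "trace_measure p \<mu> = weighted_points X (\<lambda>x. \<Sum>i<p. A x $$ (i, i))"
      unfolding trace_measure_def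
    proof (rule measure_of_weighted_points[OF X])
      show "0 \<le> (\<Sum>i<p. A x $$ (i, i))" if "x \<in> X" for x
        using psd_diag_nonneg[OF A[OF that]] by (intro sum_nonneg) auto
      show "ennreal (\<Sum>i<p. \<mu> \<Delta> $$ (i, i)) = ennreal (\<Sum>x\<in>X. (\<Sum>i<p. A x $$ (i, i)) * indicator \<Delta> x)"
        if "\<Delta> \<in> sets borel" for \<Delta>
        using \<mu>[OF that] by (simp add: sum_distrib_right sum.swap[of _ X])
    qed
    then show ?thesis
      using psd_diag_nonneg[OF A]
      by (auto intro!: integral_weighted_points(1) X sum_nonneg borel_measurable_poly)
  qed
  show ?thesis
  proof (intro iffI allI impI)
    fix k c d assume "representing_measure p n L \<mu>" "k \<le> 2 * n" "c < p" "d < p"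
    then have "moment L k = matrix_integral p \<mu> (poly (Polynomial.monom 1 k))"
      by (simp add: representing_measure_def moment_def degree_monom_eq)
    then show "moment L k $$ (c, d) = (\<Sum>x\<in>X. x ^ k * A x $$ (c, d))"
      using int \<open>c < p\<close> \<open>d < p\<close> by (simp add: poly_monom mult.commute)
  next
    assume mom: "\<forall>k\<le>2 * n. \<forall>c<p. \<forall>d<p. moment L k $$ (c, d) = (\<Sum>x\<in>X. x ^ k * A x $$ (c, d))"
    show "representing_measure p n L \<mu>"
      unfolding representing_measure_def
    proof (intro conjI allI impI)
      show "pos_matrix_measure p \<mu>" by (rule atomic_form_pos_matrix_measure[OF at])
      show "integrable (trace_measure p \<mu>) (poly q)" for q by (rule tr)
      fix q :: "real poly" assume q: "degree q \<le> 2 * n"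
      have pq: "poly q x = (\<Sum>i\<le>2 * n. Polynomial.coeff q i * x ^ i)" for x
      proof -
        have "poly q x = poly (\<Sum>i\<le>2 * n. Polynomial.monom (Polynomial.coeff q i) i) x"
          by (simp only: poly_as_sum_of_monoms'[OF q])
        then show ?thesis by (simp add: poly_sum poly_monom)
      qed
      show "L q = matrix_integral p \<mu> (poly q)"
      proof (rule eq_matI)
        fix c d assume "c < dim_row (matrix_integral p \<mu> (poly q))" "d < dim_col (matrix_integral p \<mu> (poly q))"
        then have cd: "c < p" "d < p" by (auto simp: matrix_integral_def)
        have "L q $$ (c, d) = (\<Sum>i\<le>2 * n. \<Sum>x\<in>X. Polynomial.coeff q i * (x ^ i * A x $$ (c, d)))"
          using mom cd by (simp add: linear_op_coeffs[OF L q cd] sum_distrib_left)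
        also have "\<dots> = (\<Sum>x\<in>X. \<Sum>i\<le>2 * n. Polynomial.coeff q i * (x ^ i * A x $$ (c, d)))"
          by (rule sum.swap)
        also have "\<dots> = (\<Sum>x\<in>X. A x $$ (c, d) * poly q x)"
          by (simp add: pq sum_distrib_left mult_ac)
        finally show "L q $$ (c, d) = matrix_integral p \<mu> (poly q) $$ (c, d)" using int[OF cd] by simp
      qed (use L q in \<open>auto simp: linear_op_def sym_mats_iff matrix_integral_def\<close>)
    qed
  qed
qed

section \<open>Quadrature formulas for a positive definite block Hankel matrix\<close>

definition vpoly_eval :: "nat \<Rightarrow> real \<Rightarrow> (nat \<times> nat \<Rightarrow> real) \<Rightarrow> nat \<Rightarrow> real" where
  "vpoly_eval k x u d = (\<Sum>j<k. x ^ j * u (j, d))"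

text \<open>A function \<open>u\<close> on pairs stands for the vector polynomial with coefficient \<open>u (i, c)\<close> at \<open>x\<^sup>i e\<^sub>c\<close>.
  Indexing by pairs instead of by \<open>i * p + c\<close> lets sums over coefficients split into sums over degrees and
  coordinates. \<open>M\<close> is the Gram matrix of the inner product of vector polynomials of degree at most \<open>n\<close>.\<close>

locale block_hankel =
  fixes n p :: nat and s :: "nat \<Rightarrow> nat \<Rightarrow> nat \<Rightarrow> real" and M :: "nat \<times> nat \<Rightarrow> nat \<times> nat \<Rightarrow> real"
  defines "M \<equiv> (\<lambda>a b. s (fst a + fst b) (snd a) (snd b))"
  assumes s_sym: "\<And>k c d. k \<le> 2 * n \<Longrightarrow> c < p \<Longrightarrow> d < p \<Longrightarrow> s k c d = s k d c"
    and M_pos: "\<And>u. \<exists>a\<in>{..<Suc n} \<times> {..<p}. u a \<noteq> 0 \<Longrightarrow> bform ({..<Suc n} \<times> {..<p}) M u u > 0"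
begin

abbreviation I0 where "I0 \<equiv> {..<n} \<times> {..<p}"
abbreviation I1 where "I1 \<equiv> {..<Suc n} \<times> {..<p}"
abbreviation Top where "Top \<equiv> {n} \<times> {..<p}"

text \<open>The form \<open>(P, Q) \<mapsto> \<langle>(x - t) P, Q\<rangle>\<close>. On \<open>I0 \<times> I0\<close> it is the shifted block Hankel matrix. On
  \<open>Top \<times> Top\<close> it would involve the moment of order \<open>2 n + 1\<close>, which is not given.\<close>

definition T :: "real \<Rightarrow> nat \<times> nat \<Rightarrow> nat \<times> nat \<Rightarrow> real" where
  "T t a b = s (fst a + fst b + 1) (snd a) (snd b) - t * M a b"

lemma I1_split: "I1 = I0 \<union> Top" "I0 \<inter> Top = {}"
  by auto

lemma M_sym: "a \<in> I1 \<Longrightarrow> b \<in> I1 \<Longrightarrow> M a b = M b a"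
  by (cases a; cases b) (auto simp: M_def s_sym add.commute)

lemma T_sym: "a \<in> I0 \<Longrightarrow> b \<in> I1 \<Longrightarrow> T t a b = T t b a"
  by (cases a; cases b) (auto simp: T_def M_def s_sym add.commute)

lemma M_kernel:
  assumes "\<And>a. a \<in> I1 \<Longrightarrow> (\<Sum>b\<in>I1. M a b * u b) = 0"
  shows "\<forall>a\<in>I1. u a = 0"
proof (rule ccontr)
  assume "\<not> (\<forall>a\<in>I1. u a = 0)"
  then have "bform I1 M u u > 0" by (intro M_pos) blast
  moreover have "bform I1 M u u = 0" using assms by (simp add: bform_mult_right)
  ultimately show False by simp
qed

text \<open>The left-hand side is \<open>M R\<close> for the coefficients \<open>R\<close> of \<open>(x - t) q\<close>, and multiplication by
  \<open>x - t\<close> is injective.\<close>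

lemma T_injective:
  assumes z: "\<And>a. a \<in> I1 \<Longrightarrow> (\<Sum>b\<in>I0. T t a b * q b) = 0"
  shows "\<forall>b\<in>I0. q b = 0"
proof -
  define R where "R b = (if fst b = 0 then 0 else q (fst b - 1, snd b))
      - t * (if fst b < n then q b else 0)" for b
  have "(\<Sum>b\<in>I1. M a b * R b) = (\<Sum>b\<in>I0. T t a b * q b)" for a
  proof -
    obtain i c where a: "a = (i, c)" by force
    have "(\<Sum>b\<in>I1. M a b * R b) = (\<Sum>j<Suc n. \<Sum>d<p. s (i + j) c d * R (j, d))"
      unfolding sum.cartesian_product by (intro sum.cong) (auto simp: M_def a)
    also have "\<dots> = (\<Sum>j<Suc n. \<Sum>d<p. s (i + j) c d * (if j = 0 then 0 else q (j - 1, d)))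
        - (\<Sum>j<Suc n. \<Sum>d<p. t * s (i + j) c d * (if j < n then q (j, d) else 0))"
      unfolding sum_subtractf[symmetric] by (intro sum.cong) (auto simp: R_def algebra_simps)
    also have "(\<Sum>j<Suc n. \<Sum>d<p. s (i + j) c d * (if j = 0 then 0 else q (j - 1, d)))
        = (\<Sum>j<n. \<Sum>d<p. s (i + j + 1) c d * q (j, d))"
      by (subst sum.lessThan_Suc_shift) simp
    also have "(\<Sum>j<Suc n. \<Sum>d<p. t * s (i + j) c d * (if j < n then q (j, d) else 0))
        = (\<Sum>j<n. \<Sum>d<p. t * s (i + j) c d * q (j, d))" by simp
    also have "(\<Sum>j<n. \<Sum>d<p. s (i + j + 1) c d * q (j, d)) - \<dots> = (\<Sum>j<n. \<Sum>d<p. T t a (j, d) * q (j, d))"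
      unfolding sum_subtractf[symmetric] by (intro sum.cong) (auto simp: T_def M_def a algebra_simps)
    also have "\<dots> = (\<Sum>b\<in>I0. T t a b * q b)"
      unfolding sum.cartesian_product by (intro sum.cong) auto
    finally show ?thesis .
  qed
  then have R0: "\<forall>b\<in>I1. R b = 0" using z by (intro M_kernel) simp
  have "q (j, d) = 0" if "j < n" "d < p" for j d
    using that(1)
  proof (induction "n - j" arbitrary: j rule: less_induct)
    case less
    have "R (Suc j, d) = 0" using R0 less.prems that(2) by auto
    then have "q (j, d) = t * (if Suc j < n then q (Suc j, d) else 0)" by (simp add: R_def)
    then show ?case using less by simp
  qed
  then show ?thesis by auto
qed

definition is_quadrature :: "real set \<Rightarrow> (real \<Rightarrow> nat \<Rightarrow> nat \<Rightarrow> real) \<Rightarrow> bool" where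
  "is_quadrature X A \<longleftrightarrow> finite X \<and>
     (\<forall>k\<le>2 * n. \<forall>c<p. \<forall>d<p. s k c d = (\<Sum>x\<in>X. x ^ k * A x c d))"

lemma quadrature_block_sum:
  assumes "is_quadrature X A" "c < p" "i + k \<le> 2 * n" "\<And>j. j < m \<Longrightarrow> j \<le> k"
  shows "(\<Sum>j<m. \<Sum>d<p. s (i + j) c d * v (j, d))
    = (\<Sum>x\<in>X. x ^ i * (\<Sum>d<p. A x c d * vpoly_eval m x v d))"
proof -
  have "(\<Sum>j<m. \<Sum>d<p. s (i + j) c d * v (j, d))
      = (\<Sum>j<m. \<Sum>d<p. \<Sum>x\<in>X. x ^ i * (A x c d * (x ^ j * v (j, d))))"
  proof (intro sum.cong refl)
    fix j d assume "j \<in> {..<m}" "d \<in> {..<p}"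
    then have "i + j \<le> 2 * n" using assms(3) assms(4)[of j] by simp
    then have "s (i + j) c d = (\<Sum>x\<in>X. x ^ (i + j) * A x c d)"
      using assms \<open>d \<in> {..<p}\<close> by (simp add: is_quadrature_def)
    then show "s (i + j) c d * v (j, d) = (\<Sum>x\<in>X. x ^ i * (A x c d * (x ^ j * v (j, d))))"
      by (simp add: sum_distrib_left power_add mult_ac)
  qed
  also have "\<dots> = (\<Sum>j<m. \<Sum>x\<in>X. \<Sum>d<p. x ^ i * (A x c d * (x ^ j * v (j, d))))"
    by (intro sum.cong refl sum.swap)
  also have "\<dots> = (\<Sum>x\<in>X. \<Sum>j<m. \<Sum>d<p. x ^ i * (A x c d * (x ^ j * v (j, d))))"
    by (rule sum.swap)
  also have "\<dots> = (\<Sum>x\<in>X. \<Sum>d<p. \<Sum>j<m. x ^ i * (A x c d * (x ^ j * v (j, d))))"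
    by (intro sum.cong refl sum.swap)
  finally show ?thesis by (simp add: vpoly_eval_def sum_distrib_left)
qed

lemma quadrature_M_apply:
  assumes "is_quadrature X A" "i \<le> n" "c < p"
  shows "(\<Sum>b\<in>I1. M (i, c) b * v b) = (\<Sum>x\<in>X. x ^ i * (\<Sum>d<p. A x c d * vpoly_eval (Suc n) x v d))"
proof -
  have "(\<Sum>b\<in>I1. M (i, c) b * v b) = (\<Sum>j<Suc n. \<Sum>d<p. s (i + j) c d * v (j, d))"
    unfolding sum.cartesian_product by (intro sum.cong) (auto simp: M_def)
  then show ?thesis using quadrature_block_sum[OF assms(1,3), of i n "Suc n" v] assms(2) by simp
qed

lemma quadrature_T_apply:
  assumes "is_quadrature X A" "c < p" "i + m \<le> 2 * n"
  shows "(\<Sum>b\<in>{..<m} \<times> {..<p}. T t (i, c) b * v b)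
    = (\<Sum>x\<in>X. (x - t) * x ^ i * (\<Sum>d<p. A x c d * vpoly_eval m x v d))"
proof -
  have "(\<Sum>b\<in>{..<m} \<times> {..<p}. T t (i, c) b * v b)
      = (\<Sum>j<m. \<Sum>d<p. T t (i, c) (j, d) * v (j, d))"
    unfolding sum.cartesian_product by (intro sum.cong) auto
  also have "\<dots> = (\<Sum>j<m. \<Sum>d<p. s (i + 1 + j) c d * v (j, d)) - t * (\<Sum>j<m. \<Sum>d<p. s (i + j) c d * v (j, d))"
    unfolding sum_distrib_left sum_subtractf[symmetric]
    by (intro sum.cong refl) (simp add: T_def M_def algebra_simps)
  also have "(\<Sum>j<m. \<Sum>d<p. s (i + j) c d * v (j, d))
      = (\<Sum>x\<in>X. x ^ i * (\<Sum>d<p. A x c d * vpoly_eval m x v d))"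
    using quadrature_block_sum[OF assms(1,2), of i m m v] assms(3) by simp
  also have "(\<Sum>j<m. \<Sum>d<p. s (i + 1 + j) c d * v (j, d))
      = (\<Sum>x\<in>X. x ^ (i + 1) * (\<Sum>d<p. A x c d * vpoly_eval m x v d))"
  proof (cases m)
    case (Suc m')
    then show ?thesis using quadrature_block_sum[OF assms(1,2), of "i + 1" m' m v] assms(3) by simp
  qed (simp add: vpoly_eval_def)
  finally show ?thesis
    by (simp add: sum_distrib_left sum_subtractf[symmetric] left_diff_distrib mult.assoc)
qed

definition annihilates :: "(real \<Rightarrow> nat \<Rightarrow> nat \<Rightarrow> real) \<Rightarrow> real \<Rightarrow> (nat \<times> nat \<Rightarrow> real) \<Rightarrow> bool" where
  "annihilates A x u \<longleftrightarrow> (\<forall>c<p. (\<Sum>d<p. A x c d * vpoly_eval (Suc n) x u d) = 0)"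

text \<open>The least possible \<open>r x\<close> is the rank of \<open>A x\<close>. The counting arguments use the rank only through
  such conditions.\<close>

definition cut_out_by :: "(real \<Rightarrow> nat \<Rightarrow> nat \<Rightarrow> real) \<Rightarrow> real set \<Rightarrow> (real \<Rightarrow> nat) \<Rightarrow> (real \<Rightarrow> nat \<Rightarrow> nat \<Rightarrow> real) \<Rightarrow> bool" where
  "cut_out_by A X r \<phi> \<longleftrightarrow> (\<forall>x\<in>X. \<forall>v. (\<forall>l<r x. (\<Sum>d<p. \<phi> x l d * v d) = 0) \<longrightarrow>
     (\<forall>c<p. (\<Sum>d<p. A x c d * v d) = 0))"

lemma cut_out_annihilates:
  assumes "cut_out_by A X r \<phi>" "x \<in> X"
    and z: "\<And>l. l < r x \<Longrightarrow> (\<Sum>b\<in>I1. \<phi> x l (snd b) * x ^ fst b * u b) = 0"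
  shows "annihilates A x u"
proof -
  have "(\<Sum>d<p. \<phi> x l d * vpoly_eval (Suc n) x u d) = 0" if "l < r x" for l
  proof -
    have "(\<Sum>d<p. \<phi> x l d * vpoly_eval (Suc n) x u d) = (\<Sum>d<p. \<Sum>j<Suc n. \<phi> x l d * x ^ j * u (j, d))"
      by (simp add: vpoly_eval_def sum_distrib_left mult.assoc del: sum.lessThan_Suc)
    also have "\<dots> = (\<Sum>j<Suc n. \<Sum>d<p. \<phi> x l d * x ^ j * u (j, d))" by (rule sum.swap)
    also have "\<dots> = (\<Sum>b\<in>I1. \<phi> x l (snd b) * x ^ fst b * u b)"
      unfolding sum.cartesian_product by (intro sum.cong) auto
    finally show ?thesis using z[OF that] by simp
  qed
  then show ?thesis using assms(1,2) unfolding cut_out_by_def annihilates_def by blast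
qed

text \<open>With too few conditions, a nonzero vector polynomial of degree at most \<open>n\<close> would be annihilated
  at every node and so be orthogonal to everything, against positive definiteness.\<close>

lemma quadrature_size_ge:
  assumes quad: "is_quadrature X A" and cut: "cut_out_by A X r \<phi>"
  shows "Suc n * p \<le> (\<Sum>x\<in>X. r x)"
proof (rule ccontr)
  assume less: "\<not> ?thesis"
  have X: "finite X" using quad by (simp add: is_quadrature_def)
  let ?E = "Sigma X (\<lambda>x. {..<r x})"
  have "finite ?E" "card ?E < card I1" using X less by (auto simp: card_cartesian_product)
  then obtain u where u: "\<exists>b\<in>I1. u b \<noteq> 0"
    and z: "\<And>e. e \<in> ?E \<Longrightarrow> (\<Sum>b\<in>I1. \<phi> (fst e) (snd e) (snd b) * fst e ^ fst b * u b) = 0"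
    using underdetermined_system[of ?E I1 "\<lambda>e b. \<phi> (fst e) (snd e) (snd b) * fst e ^ fst b"] by auto
  have "annihilates A x u" if "x \<in> X" for x
    using cut that by (rule cut_out_annihilates) (use z that in force)
  then have "(\<Sum>b\<in>I1. M a b * u b) = 0" if "a \<in> I1" for a
    using that quadrature_M_apply[OF quad, of "fst a" "snd a" u]
    by (cases a) (auto simp: annihilates_def)
  then have "\<forall>b\<in>I1. u b = 0" by (rule M_kernel)
  then show False using u by blast
qed

text \<open>Let \<open>P\<close> be annihilated at all nodes except \<open>t\<close>; then \<open>\<langle>(x - t) P, Q\<rangle> = 0\<close> for all \<open>Q\<close>
  of degree less than \<open>n\<close>. If \<open>Q\<close> lies in the kernel of the shifted matrix, only the leading
  coefficient of \<open>P\<close> contributes to this pairing, so it is orthogonal to the vector \<open>h\<^sup>T Q\<close> with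
  entries \<open>\<langle>(x - t) x\<^sup>n e\<^sub>c, Q\<rangle>\<close>. If the asserted inequality failed, counting would yield a nonzero pair
  \<open>(P, Q)\<close> of this kind for which the leading coefficient of \<open>P\<close> equals \<open>h\<^sup>T Q\<close>. This vector is then orthogonal to itself, hence 0,
  and injectivity of \<open>T\<close> gives \<open>P = 0\<close> and \<open>Q = 0\<close>.\<close>

lemma multiplicity_bound:
  assumes quad: "is_quadrature X A" and cut: "cut_out_by A X r \<phi>"
    and size: "(\<Sum>x\<in>X. r x) \<le> Suc n * p"
    and \<psi>: "\<And>q a. (\<And>l. l < h \<Longrightarrow> (\<Sum>b\<in>I0. \<psi> l b * q b) = 0) \<Longrightarrow> a \<in> I0 \<Longrightarrow> (\<Sum>b\<in>I0. T t a b * q b) = 0"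
  shows "(if t \<in> X then r t else 0) + n * p \<le> h + p"
proof (rule ccontr)
  assume less: "\<not> ?thesis"
  have X: "finite X" using quad by (simp add: is_quadrature_def)
  let ?E1 = "Sigma (X - {t}) (\<lambda>x. {..<r x})"
  let ?E = "?E1 <+> ({..<h} <+> {..<p})"
  let ?J = "I1 <+> I0"
  have "(\<Sum>x\<in>X. r x) = (\<Sum>x\<in>X - {t}. r x) + (if t \<in> X then r t else 0)"
    using X by (cases "t \<in> X") (simp_all add: sum.remove)
  moreover have "card ?E = (\<Sum>x\<in>X - {t}. r x) + h + p" using X by (simp add: card_Plus)
  moreover have "card ?J = Suc n * p + n * p" by (simp add: card_Plus card_cartesian_product)
  ultimately have "card ?E < card ?J" using less size by linarith
  moreover have "finite ?E" "finite ?J" using X by auto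
  \<comment> \<open>The unknowns are \<open>P\<close> on the left and \<open>Q\<close> on the right. The equations are: \<open>P\<close> is annihilated at
    the nodes other than \<open>t\<close>; \<open>Q\<close> is in the kernel of the shifted matrix; the leading coefficient of
    \<open>P\<close> is \<open>h\<^sup>T Q\<close>.\<close>
  moreover define cf where "cf e b = (case e of
        Inl (x, l) \<Rightarrow> (case b of Inl a \<Rightarrow> \<phi> x l (snd a) * x ^ fst a | Inr a \<Rightarrow> 0)
      | Inr (Inl l) \<Rightarrow> (case b of Inl a \<Rightarrow> 0 | Inr a \<Rightarrow> \<psi> l a)
      | Inr (Inr c) \<Rightarrow> (case b of Inl a \<Rightarrow> (if (n, c) = a then 1 else 0) | Inr a \<Rightarrow> - T t (n, c) a))" for e b
  ultimately obtain y where y: "\<exists>b\<in>?J. y b \<noteq> 0"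
    and z: "\<And>e. e \<in> ?E \<Longrightarrow> (\<Sum>b\<in>?J. cf e b * y b) = 0"
    using underdetermined_system[of ?E ?J cf] by blast
  define P where "P a = y (Inl a)" for a
  define Q where "Q a = y (Inr a)" for a
  have fin: "finite I1" "finite I0" by auto
  have ann: "annihilates A x P" if "x \<in> X" "x \<noteq> t" for x
    using cut that(1)
  proof (rule cut_out_annihilates)
    fix l assume "l < r x"
    then have "Inl (x, l) \<in> ?E" using that by auto
    from z[OF this] show "(\<Sum>b\<in>I1. \<phi> x l (snd b) * x ^ fst b * P b) = 0"
      by (simp add: sum.Plus[OF fin] P_def cf_def)
  qed
  have HQ: "(\<Sum>b\<in>I0. T t a b * Q b) = 0" if "a \<in> I0" for a
  proof (rule \<psi>[OF _ that])
    fix l assume "l < h"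
    then have "Inr (Inl l) \<in> ?E" by auto
    from z[OF this] show "(\<Sum>b\<in>I0. \<psi> l b * Q b) = 0"
      by (simp add: sum.Plus[OF fin] Q_def cf_def)
  qed
  have top: "P (n, c) = (\<Sum>b\<in>I0. T t (n, c) b * Q b)" if "c < p" for c
  proof -
    have "Inr (Inr c) \<in> ?E" using that by auto
    from z[OF this] have "(\<Sum>a\<in>I1. (if (n, c) = a then 1 else 0) * P a) + (\<Sum>b\<in>I0. - T t (n, c) b * Q b) = 0"
      by (simp only: sum.Plus[OF fin] P_def Q_def cf_def sum.case old.sum.case o_def)
    then show ?thesis using that by (simp add: sum_indicator_mult[OF fin(1)] sum_negf)
  qed
  have TP: "(\<Sum>b\<in>I1. T t a b * P b) = 0" if "a \<in> I0" for a
  proof -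
    obtain i c where a: "a = (i, c)" "i < n" "c < p" using \<open>a \<in> I0\<close> by auto
    have "(\<Sum>b\<in>I1. T t a b * P b) = (\<Sum>x\<in>X. (x - t) * x ^ i * (\<Sum>d<p. A x c d * vpoly_eval (Suc n) x P d))"
      unfolding a(1) by (rule quadrature_T_apply[OF quad]) (use a in auto)
    also have "\<dots> = 0" using ann a by (intro sum.neutral) (auto simp: annihilates_def)
    finally show ?thesis .
  qed
  have "(\<Sum>c<p. P (n, c) * P (n, c)) = 0"
  proof -
    have "0 = (\<Sum>a\<in>I0. Q a * (\<Sum>b\<in>I1. T t a b * P b))" using TP by simp
    also have "\<dots> = (\<Sum>a\<in>I0. \<Sum>b\<in>I1. P b * (T t b a * Q a))"
    proof -
      have "Q a * (T t a b * P b) = P b * (T t b a * Q a)" if "a \<in> I0" "b \<in> I1" for a b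
        by (subst T_sym[OF that]) simp
      then show ?thesis unfolding sum_distrib_left by (intro sum.cong refl)
    qed
    also have "\<dots> = (\<Sum>b\<in>I1. \<Sum>a\<in>I0. P b * (T t b a * Q a))" by (rule sum.swap)
    also have "\<dots> = (\<Sum>b\<in>I1. P b * (\<Sum>a\<in>I0. T t b a * Q a))" by (simp add: sum_distrib_left)
    also have "\<dots> = (\<Sum>b\<in>I0. P b * (\<Sum>a\<in>I0. T t b a * Q a)) + (\<Sum>b\<in>Top. P b * (\<Sum>a\<in>I0. T t b a * Q a))"
      unfolding I1_split(1) by (rule sum.union_disjoint) auto
    also have "(\<Sum>b\<in>I0. P b * (\<Sum>a\<in>I0. T t b a * Q a)) = 0" using HQ by simp
    also have "(\<Sum>b\<in>Top. P b * (\<Sum>a\<in>I0. T t b a * Q a)) = (\<Sum>b\<in>Top. P b * P b)"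
      using top by (intro sum.cong) auto
    also have "\<dots> = (\<Sum>c<p. P (n, c) * P (n, c))"
      by (intro sum.reindex_bij_witness[of _ "\<lambda>c. (n, c)" snd]) auto
    finally show ?thesis by simp
  qed
  then have P_top: "P (n, c) = 0" if "c < p" for c
    using that by (subst (asm) sum_nonneg_eq_0_iff) auto
  have "\<forall>b\<in>I0. Q b = 0"
  proof (rule T_injective[of t])
    fix a assume "a \<in> I1"
    then show "(\<Sum>b\<in>I0. T t a b * Q b) = 0" unfolding I1_split(1) using HQ top P_top by auto
  qed
  moreover have "\<forall>b\<in>I0. P b = 0"
  proof (rule T_injective[of t])
    fix a assume "a \<in> I1"
    then obtain i c where a: "a = (i, c)" "i \<le> n" "c < p" by auto
    have "(\<Sum>b\<in>I0. T t a b * P b) = (\<Sum>x\<in>X. (x - t) * x ^ i * (\<Sum>d<p. A x c d * vpoly_eval n x P d))"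
      unfolding a(1) by (rule quadrature_T_apply[OF quad]) (use a in auto)
    also have "\<dots> = (\<Sum>x\<in>X. (x - t) * x ^ i * (\<Sum>d<p. A x c d * vpoly_eval (Suc n) x P d))"
      using P_top by (intro sum.cong refl) (simp add: vpoly_eval_def)
    also have "\<dots> = 0" using ann a by (intro sum.neutral) (auto simp: annihilates_def)
    finally show "(\<Sum>b\<in>I0. T t a b * P b) = 0" .
  qed
  ultimately have "y b = 0" if "b \<in> ?J" for b
    using that P_top unfolding I1_split(1) by (auto simp: P_def Q_def)
  then show False using y by blast
qed

text \<open>A completion \<open>B'\<close> of \<open>T\<close> amounts to a choice of the missing moment. Diagonalize \<open>M\<close> and
  \<open>B'\<close> simultaneously, with eigenvalues \<open>\<theta> l\<close> and vectors \<open>v l = M (w l)\<close>. The rows of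
  \<open>B'\<close> and \<open>M\<close> belonging to degree \<open>j < n\<close> are related by the Hankel shift, and the eigenvalue equation
  becomes the recursion \<open>v l (j + 1, d) = (\<theta> l + t) v l (j, d)\<close>. Hence \<open>v l\<close> is geometric in the degree, and
  the factorization of \<open>M\<close> reads as a quadrature formula with rank one weights at the nodes \<open>\<theta> l + t\<close>.
  In particular the multiplicity of \<open>t\<close> is the nullity of \<open>B'\<close>.\<close>

lemma quadrature_of_completion:
  assumes B': "\<And>a b. a \<in> I0 \<Longrightarrow> b \<in> I1 \<Longrightarrow> B' a b = T t a b"
    and B'_sym: "\<And>a b. a \<in> I1 \<Longrightarrow> b \<in> I1 \<Longrightarrow> B' a b = B' b a"
  obtains w \<theta> and g :: "nat \<Rightarrow> nat \<Rightarrow> real" where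
    "\<forall>k<card I1. \<forall>l<card I1. bform I1 M (w k) (w l) = (if k = l then 1 else 0)"
    "\<forall>k<card I1. \<forall>a\<in>I1. (\<Sum>b\<in>I1. B' a b * w k b) = \<theta> k * (\<Sum>b\<in>I1. M a b * w k b)"
    "\<forall>k\<le>2 * n. \<forall>c<p. \<forall>d<p. s k c d = (\<Sum>l<card I1. (\<theta> l + t) ^ k * (g l c * g l d))"
    "\<forall>l<card I1. \<exists>c<p. g l c \<noteq> 0"
proof -
  interpret sym_pencil I1 M B'
    by unfold_locales (use M_sym M_pos B'_sym in auto)
  obtain w \<theta> where
    orth: "\<And>k l. k < card I1 \<Longrightarrow> l < card I1 \<Longrightarrow> bform I1 M (w k) (w l) = (if k = l then 1 else 0)"
    and eig: "\<And>k a. k < card I1 \<Longrightarrow> a \<in> I1 \<Longrightarrow> (\<Sum>b\<in>I1. B' a b * w k b) = \<theta> k * (\<Sum>b\<in>I1. M a b * w k b)"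
    by (rule simultaneous_diagonalization) blast
  define v where "v l a = (\<Sum>b\<in>I1. M a b * w l b)" for l a
  have step: "v l (Suc j, d) = (\<theta> l + t) * v l (j, d)" if "l < card I1" "j < n" "d < p" for l j d
  proof -
    have "\<theta> l * v l (j, d) = (\<Sum>b\<in>I1. T t (j, d) b * w l b)"
      using eig[OF that(1), of "(j, d)"] B' that by (simp add: v_def)
    also have "\<dots> = v l (Suc j, d) - t * v l (j, d)"
      unfolding v_def sum_distrib_left sum_subtractf[symmetric]
      by (intro sum.cong refl) (simp add: T_def M_def algebra_simps)
    finally show ?thesis by (simp add: algebra_simps)
  qed
  have geom: "v l (j, d) = (\<theta> l + t) ^ j * v l (0, d)" if "l < card I1" "j \<le> n" "d < p" for l j d
    using that(2) by (induction j) (use step that in auto)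
  show ?thesis
  proof (rule that[of w \<theta> "\<lambda>l c. v l (0, c)"]; intro allI impI ballI)
    show "s k c d = (\<Sum>l<card I1. (\<theta> l + t) ^ k * (v l (0, c) * v l (0, d)))"
      if "k \<le> 2 * n" "c < p" "d < p" for k c d
    proof -
      define i where "i = min k n"
      define j where "j = k - i"
      have ij: "i \<le> n" "j \<le> n" "k = i + j" using that(1) by (auto simp: i_def j_def)
      have "s k c d = M (i, c) (j, d)" by (simp add: M_def ij)
      also have "\<dots> = (\<Sum>l<card I1. v l (i, c) * v l (j, d))"
        unfolding v_def by (rule orthonormal_factorization[OF orth]) (use ij that in auto)
      also have "\<dots> = (\<Sum>l<card I1. (\<theta> l + t) ^ k * (v l (0, c) * v l (0, d)))"
      proof (intro sum.cong refl)
        fix l assume "l \<in> {..<card I1}"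
        then have l: "l < card I1" by simp
        show "v l (i, c) * v l (j, d) = (\<theta> l + t) ^ k * (v l (0, c) * v l (0, d))"
          unfolding geom[OF l ij(1) that(2)] geom[OF l ij(2) that(3)] ij(3) power_add by simp
      qed
      finally show ?thesis .
    qed
    show "\<exists>c<p. v l (0, c) \<noteq> 0" if l: "l < card I1" for l
    proof (rule ccontr)
      assume z: "\<not> ?thesis"
      have "(\<Sum>b\<in>I1. M a b * w l b) = 0" if "a \<in> I1" for a
      proof -
        obtain i c where a: "a = (i, c)" "i \<le> n" "c < p" using \<open>a \<in> I1\<close> by auto
        have "v l a = 0" unfolding a(1) geom[OF l a(2,3)] using z a(3) by simp
        then show ?thesis by (simp add: v_def)
      qed
      then have "bform I1 M (w l) (w l) = 0" by (simp add: bform_mult_right)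
      then show False using orth[OF l l] by simp
    qed
  qed (use orth eig in auto)
qed

lemma quadrature_exists:
  obtains x :: "nat \<Rightarrow> real" and g where
    "\<forall>k\<le>2 * n. \<forall>c<p. \<forall>d<p. s k c d = (\<Sum>l<Suc n * p. x l ^ k * (g l c * g l d))"
    "\<forall>l<Suc n * p. \<exists>c<p. g l c \<noteq> 0"
proof -
  \<comment> \<open>Any completion will do; this one puts 0 into the free corner.\<close>
  define B' where "B' a b = (if a \<in> I0 \<or> b \<in> I0 then T 0 a b else 0)" for a b
  have B'_sym: "B' a b = B' b a" if "a \<in> I1" "b \<in> I1" for a b
    using T_sym[of a b 0] T_sym[of b a 0] that by (auto simp: B'_def)
  have corner: "B' a b = T 0 a b" if "a \<in> I0" for a b using that by (simp add: B'_def)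
  obtain w :: "nat \<Rightarrow> nat \<times> nat \<Rightarrow> real" and \<theta> g where
    "\<forall>k<card I1. \<forall>l<card I1. bform I1 M (w k) (w l) = (if k = l then 1 else 0)"
    "\<forall>k<card I1. \<forall>a\<in>I1. (\<Sum>b\<in>I1. B' a b * w k b) = \<theta> k * (\<Sum>b\<in>I1. M a b * w k b)"
    "\<forall>k\<le>2 * n. \<forall>c<p. \<forall>d<p. s k c d = (\<Sum>l<card I1. (\<theta> l + 0) ^ k * (g l c * g l d))"
    "\<forall>l<card I1. \<exists>c<p. g l c \<noteq> 0"
    by (rule quadrature_of_completion[of B' 0, OF corner B'_sym])
  then show ?thesis using that[of \<theta> g] by (simp add: card_cartesian_product)
qed

lemma quadrature_with_multiplicity:
  assumes rank: "\<And>(K :: nat set) \<phi>. finite K \<Longrightarrow>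
       (\<And>q a. (\<And>k. k \<in> K \<Longrightarrow> (\<Sum>b\<in>I0. \<phi> k b * q b) = 0) \<Longrightarrow> a \<in> I0 \<Longrightarrow> (\<Sum>b\<in>I0. T t a b * q b) = 0)
       \<Longrightarrow> h \<le> card K"
    and m: "m + n * p \<le> h + p"
  obtains x :: "nat \<Rightarrow> real" and g where
    "\<forall>k\<le>2 * n. \<forall>c<p. \<forall>d<p. s k c d = (\<Sum>l<Suc n * p. x l ^ k * (g l c * g l d))"
    "\<forall>l<Suc n * p. \<exists>c<p. g l c \<noteq> 0"
    "card {l. l < Suc n * p \<and> x l = t} = m"
proof -
  define B where "B a b = (if a \<in> I0 \<or> b \<in> I0 then T t a b else 0)" for a b
  have B_sym: "B a b = B b a" if "a \<in> I0 \<union> Top" "b \<in> I0 \<union> Top" for a b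
    using T_sym[of a b t] T_sym[of b a t] that by (auto simp: B_def)
  have B_T: "B a b = T t a b" if "b \<in> I0" for a b using that by (simp add: B_def)
  have inj: "\<forall>b\<in>I0. q b = 0" if "\<And>a. a \<in> I0 \<union> Top \<Longrightarrow> (\<Sum>b\<in>I0. B a b * q b) = 0" for q
  proof (rule T_injective[of t])
    fix a assume "a \<in> I1"
    then show "(\<Sum>b\<in>I0. T t a b * q b) = 0" using that[of a] B_T unfolding I1_split(1) by simp
  qed
  have rank': "h \<le> card K" if "finite K" "\<And>q a. (\<And>k. k \<in> K \<Longrightarrow> (\<Sum>b\<in>I0. \<phi> k b * q b) = 0)
      \<Longrightarrow> a \<in> I0 \<Longrightarrow> (\<Sum>b\<in>I0. B a b * q b) = 0" for K :: "nat set" and \<phi>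
    using rank[OF that(1), of \<phi>] that(2) B_T by simp
  have fin: "finite I0" "finite Top" by auto
  have m': "m + card I0 \<le> h + card Top" using m by (simp add: card_cartesian_product)
  obtain B' f P where
    B': "\<forall>a\<in>I0. \<forall>b. B' a b = B a b"
    and B'_sym: "\<forall>a\<in>I0 \<union> Top. \<forall>b\<in>I0 \<union> Top. B' a b = B' b a"
    and upper: "\<forall>u. (\<forall>a\<in>I0 \<union> Top. (\<Sum>b\<in>I0 \<union> Top. B' a b * u b) = 0) \<longrightarrow>
       (\<forall>l<m. (\<Sum>c\<in>Top. f l c * u c) = 0) \<longrightarrow> (\<forall>a\<in>I0 \<union> Top. u a = 0)"
    and ker: "\<forall>l<m. \<forall>a\<in>I0 \<union> Top. (\<Sum>b\<in>I0 \<union> Top. B' a b * P l b) = 0"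
    and indep: "\<forall>\<xi>. (\<forall>c\<in>Top. (\<Sum>l<m. \<xi> l * P l c) = 0) \<longrightarrow> (\<forall>l<m. \<xi> l = 0)"
  proof (rule completion_with_nullity[OF fin I1_split(2) B_sym inj _ m'])
    show "h \<le> card K" if "finite K" "\<And>q a. (\<And>k. k \<in> K \<Longrightarrow> (\<Sum>b\<in>I0. \<phi> k b * q b) = 0)
        \<Longrightarrow> a \<in> I0 \<Longrightarrow> (\<Sum>b\<in>I0. B a b * q b) = 0" for K :: "nat set" and \<phi>
      using rank'[OF that(1), of \<phi>] that(2) by blast
  qed
  note compl = B'_sym[folded I1_split(1)] upper[folded I1_split(1)] ker[folded I1_split(1)]
  interpret sym_pencil I1 M B'
    by unfold_locales (use M_sym M_pos compl(1) in auto)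
  have B'_T: "B' a b = T t a b" if "a \<in> I0" for a b using bspec[OF B' that, THEN spec, of b] that by (simp add: B_def)
  obtain w \<theta> g where
    orth: "\<forall>k<card I1. \<forall>l<card I1. bform I1 M (w k) (w l) = (if k = l then 1 else 0)"
    and eig: "\<forall>k<card I1. \<forall>a\<in>I1. (\<Sum>b\<in>I1. B' a b * w k b) = \<theta> k * (\<Sum>b\<in>I1. M a b * w k b)"
    and q: "\<forall>k\<le>2 * n. \<forall>c<p. \<forall>d<p. s k c d = (\<Sum>l<card I1. (\<theta> l + t) ^ k * (g l c * g l d))"
    "\<forall>l<card I1. \<exists>c<p. g l c \<noteq> 0"
    by (rule quadrature_of_completion[of B' t, OF B'_T compl(1)[rule_format]])
  have "card {k. k < card I1 \<and> \<theta> k = 0} = m"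
  proof (rule card_zero_eigenvalues[OF orth[rule_format] eig[rule_format]])
    show "\<forall>a\<in>I1. u a = 0" if "\<And>a. a \<in> I1 \<Longrightarrow> (\<Sum>b\<in>I1. B' a b * u b) = 0"
      "\<And>l. l < m \<Longrightarrow> (\<Sum>c\<in>Top. f l c * u c) = 0" for u
      using compl(2) that by blast
    show "(\<Sum>b\<in>I1. B' a b * P l b) = 0" if "l < m" "a \<in> I1" for l a
      using compl(3) that by blast
    show "\<forall>l<m. \<xi> l = 0" if "\<And>a. a \<in> I1 \<Longrightarrow> (\<Sum>l<m. \<xi> l * P l a) = 0" for \<xi>
      using indep that by force
  qed
  moreover have "(\<theta> l + t = t) = (\<theta> l = 0)" for l by simp
  ultimately show ?thesis using that[of "\<lambda>l. \<theta> l + t" g] q by (simp add: card_cartesian_product)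
qed

end

section \<open>From block matrices to pairs of indices\<close>

lemma bij_betw_div_mod:
  fixes k p :: nat
  shows "bij_betw (\<lambda>a. (a div p, a mod p)) {..<k * p} ({..<k} \<times> {..<p})"
proof (rule bij_betw_byWitness[where f' = "\<lambda>b. fst b * p + snd b"])
  show "(\<lambda>a. (a div p, a mod p)) ` {..<k * p} \<subseteq> {..<k} \<times> {..<p}"
    by (auto simp: less_mult_imp_div_less) (metis gr_zeroI mod_less_divisor mult_0_right not_less_zero)
  show "(\<lambda>b. fst b * p + snd b) ` ({..<k} \<times> {..<p}) \<subseteq> {..<k * p}"
  proof clarsimp
    fix i c assume "i < k" "c < p"
    then have "Suc i * p \<le> k * p" by (intro mult_le_mono1) simp
    then show "i * p + c < k * p" using \<open>c < p\<close> by simp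
  qed
qed auto

lemma sum_div_mod:
  fixes k p :: nat
  shows "(\<Sum>a<k * p. f (a div p, a mod p)) = (\<Sum>b\<in>{..<k} \<times> {..<p}. f b)"
  by (rule sum.reindex_bij_betw[OF bij_betw_div_mod])

lemma bform_div_mod:
  fixes k p :: nat
  shows "bform {..<k * p} (\<lambda>a b. N (a div p, a mod p) (b div p, b mod p))
      (\<lambda>a. u (a div p, a mod p)) (\<lambda>a. v (a div p, a mod p)) = bform ({..<k} \<times> {..<p}) N u v"
  unfolding bform_def sum_div_mod[symmetric] ..

lemma block_index:
  fixes k p i c :: nat
  assumes "i < k" "c < p"
  shows "i * p + c < k * p" "(i * p + c) div p = i" "(i * p + c) mod p = c"
proof -
  have "Suc i * p \<le> k * p" using assms(1) by (intro mult_le_mono1) simp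
  then show "i * p + c < k * p" using assms(2) by simp
qed (use assms in auto)

lemma block_matrix_apply:
  assumes "i < k" "c < p"
  shows "(\<Sum>b<k * p. block_matrix p k B $$ (i * p + c, b) * v (b div p, b mod p))
    = (\<Sum>b\<in>{..<k} \<times> {..<p}. B i (fst b) $$ (c, snd b) * v b)"
  unfolding sum_div_mod[symmetric] using block_index[OF assms]
  by (intro sum.cong) (auto simp: block_matrix_def)

lemma mat_rank_zero: "mat_rank (0\<^sub>m k k) = 0"
  using mat_rank_le_card[of "0\<^sub>m k k" k k "{}" "\<lambda>_ _. 0"] by simp

section \<open>The truncated matricial moment problem\<close>

lemma atom_mult_atomic:
  assumes at: "atomic_form p \<mu> X A"
  shows "atom_mult \<mu> t = (if t \<in> X then mat_rank (A t) else 0)"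
proof -
  have X: "finite X" and A: "\<And>x. x \<in> X \<Longrightarrow> A x \<in> carrier_mat p p"
    and \<mu>: "\<mu> {t} = mat p p (\<lambda>(i, j). \<Sum>x\<in>X. A x $$ (i, j) * indicator {t} x)"
    using at by (auto simp: atomic_form_def pos_semidef_iff)
  have entry: "(\<Sum>x\<in>X. A x $$ (i, j) * indicator {t} x) = (if t \<in> X then A t $$ (i, j) else 0)" for i j
  proof -
    have "(\<Sum>x\<in>X. A x $$ (i, j) * indicator {t} x) = (\<Sum>x\<in>X. if x = t then A t $$ (i, j) else 0)"
      by (intro sum.cong) auto
    then show ?thesis using X by simp
  qed
  have "\<mu> {t} = (if t \<in> X then A t else 0\<^sub>m p p)"
    unfolding \<mu> entry using A[of t] by (intro eq_matI) auto
  then show ?thesis by (simp add: atom_mult_def mat_rank_zero[simplified])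
qed

locale moment_problem =
  fixes n p :: nat and L :: "real poly \<Rightarrow> real mat"
  assumes linear: "linear_op p (2 * n) L"
    and positive: "pos_def ((n + 1) * p) (moment_matrix p n L)"
begin

abbreviation s where "s k c d \<equiv> moment L k $$ (c, d)"

sublocale block_hankel n p s "\<lambda>a b. s (fst a + fst b) (snd a) (snd b)"
proof unfold_locales
  show "s k c d = s k d c" if "k \<le> 2 * n" "c < p" "d < p" for k c d
    using linear that by (simp add: linear_op_def moment_def degree_monom_eq sym_mats_iff)
next
  fix u :: "nat \<times> nat \<Rightarrow> real"
  let ?I = "{..<Suc n} \<times> {..<p}" and ?M = "\<lambda>a b. s (fst a + fst b) (snd a) (snd b)"
  let ?v = "\<lambda>a. u (a div p, a mod p)"
  assume "\<exists>a\<in>?I. u a \<noteq> 0"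
  then obtain i c where ic: "i < Suc n" "c < p" "u (i, c) \<noteq> 0" by auto
  then have "\<exists>a<(n + 1) * p. ?v a \<noteq> 0" using block_index[OF ic(1,2)] by (intro exI[of _ "i * p + c"]) simp
  then have "bform {..<(n + 1) * p} (\<lambda>c d. moment_matrix p n L $$ (c, d)) ?v ?v > 0"
    by (rule pos_def_imp_bform[OF positive])
  also have "bform {..<(n + 1) * p} (\<lambda>c d. moment_matrix p n L $$ (c, d)) ?v ?v
      = bform {..<(n + 1) * p} (\<lambda>a b. ?M (a div p, a mod p) (b div p, b mod p)) ?v ?v"
    unfolding bform_def by (intro sum.cong refl) (simp add: moment_matrix_def block_matrix_def)
  also have "\<dots> = bform ?I ?M u u"
    using bform_div_mod[where k = "n + 1" and p = p and N = ?M and u = u and v = u] by simp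
  finally show "bform ?I ?M u u > 0" .
qed

lemma shifted_apply:
  assumes "i < n" "c < p"
  shows "(\<Sum>b<n * p. shifted_matrix p n L t $$ (i * p + c, b) * v (b div p, b mod p))
    = (\<Sum>b\<in>I0. T t (i, c) b * v b)"
proof -
  have dim: "moment L k \<in> carrier_mat p p" if "k \<le> 2 * n" for k
    using linear that by (simp add: linear_op_def moment_def degree_monom_eq sym_mats_iff)
  have "(\<Sum>b<n * p. shifted_matrix p n L t $$ (i * p + c, b) * v (b div p, b mod p))
      = (\<Sum>b\<in>I0. (moment L (i + fst b + 1) - t \<cdot>\<^sub>m moment L (i + fst b)) $$ (c, snd b) * v b)"
    unfolding shifted_matrix_def by (rule block_matrix_apply[OF assms])
  also have "\<dots> = (\<Sum>b\<in>I0. T t (i, c) b * v b)"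
  proof (intro sum.cong refl)
    fix b assume "b \<in> I0"
    then obtain j d where b: "b = (j, d)" "j < n" "d < p" by auto
    have "moment L (i + j) \<in> carrier_mat p p" by (rule dim) (use b assms in simp)
    then have "(moment L (i + j + 1) - t \<cdot>\<^sub>m moment L (i + j)) $$ (c, d) = T t (i, c) b"
      using assms b by (simp add: T_def)
    then show "(moment L (i + fst b + 1) - t \<cdot>\<^sub>m moment L (i + fst b)) $$ (c, snd b) * v b = T t (i, c) b * v b"
      by (simp add: b)
  qed
  finally show ?thesis .
qed

lemma shifted_carrier: "shifted_matrix p n L t \<in> carrier_mat (n * p) (n * p)"
  by (simp add: shifted_matrix_def block_matrix_def)

lemma shifted_rank_functionals:
  obtains \<psi> :: "nat \<Rightarrow> nat \<times> nat \<Rightarrow> real" where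
    "\<And>q a. (\<And>l. l < mat_rank (shifted_matrix p n L t) \<Longrightarrow> (\<Sum>b\<in>I0. \<psi> l b * q b) = 0) \<Longrightarrow> a \<in> I0 \<Longrightarrow>
       (\<Sum>b\<in>I0. T t a b * q b) = 0"
proof -
  obtain \<phi> :: "nat \<Rightarrow> nat \<Rightarrow> real" where \<phi>:
    "\<And>q i. (\<And>l. l < mat_rank (shifted_matrix p n L t) \<Longrightarrow> (\<Sum>j<n * p. \<phi> l j * q j) = 0) \<Longrightarrow> i < n * p \<Longrightarrow>
       (\<Sum>j<n * p. shifted_matrix p n L t $$ (i, j) * q j) = 0"
    using mat_rank_functionals[OF shifted_carrier] by blast
  show ?thesis
  proof (rule that[of "\<lambda>l b. \<phi> l (fst b * p + snd b)"])
    fix q a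
    assume z: "\<And>l. l < mat_rank (shifted_matrix p n L t) \<Longrightarrow> (\<Sum>b\<in>I0. \<phi> l (fst b * p + snd b) * q b) = 0"
      and "a \<in> I0"
    then obtain i c where a: "a = (i, c)" "i < n" "c < p" by auto
    have "(\<Sum>j<n * p. shifted_matrix p n L t $$ (i * p + c, j) * q (j div p, j mod p)) = 0"
    proof (rule \<phi>)
      fix l assume "l < mat_rank (shifted_matrix p n L t)"
      from z[OF this] show "(\<Sum>j<n * p. \<phi> l j * q (j div p, j mod p)) = 0"
        unfolding sum_div_mod[symmetric] by simp
    qed (use block_index[OF a(2,3)] in simp)
    then show "(\<Sum>b\<in>I0. T t a b * q b) = 0" unfolding a(1) shifted_apply[OF a(2,3)] .
  qed
qed

lemma shifted_rank_le:
  fixes K :: "nat set"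
  assumes "finite K" and z: "\<And>q a. (\<And>k. k \<in> K \<Longrightarrow> (\<Sum>b\<in>I0. \<phi> k b * q b) = 0) \<Longrightarrow> a \<in> I0 \<Longrightarrow>
       (\<Sum>b\<in>I0. T t a b * q b) = 0"
  shows "mat_rank (shifted_matrix p n L t) \<le> card K"
proof (rule mat_rank_le_card[OF shifted_carrier assms(1), where \<phi> = "\<lambda>k j. \<phi> k (j div p, j mod p)"])
  fix q :: "nat \<Rightarrow> real" and a
  assume ann: "\<And>k. k \<in> K \<Longrightarrow> (\<Sum>j<n * p. \<phi> k (j div p, j mod p) * q j) = 0" and a: "a < n * p"
  define q' where "q' b = q (fst b * p + snd b)" for b
  have q: "q j = q' (j div p, j mod p)" for j by (simp add: q'_def)
  have ic: "a div p < n" "a mod p < p" using bij_betwE[OF bij_betw_div_mod[of p n]] a by auto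
  have "(\<Sum>b\<in>I0. T t (a div p, a mod p) b * q' b) = 0"
  proof (rule z)
    fix k assume "k \<in> K"
    from ann[OF this] show "(\<Sum>b\<in>I0. \<phi> k b * q' b) = 0"
      unfolding q sum_div_mod[of "\<lambda>b. \<phi> k b * q' b" p n] .
  qed (use ic in simp)
  then show "(\<Sum>j<n * p. shifted_matrix p n L t $$ (a, j) * q j) = 0"
    using shifted_apply[OF ic, of t q'] unfolding q by simp
qed

lemma representing_iff_quadrature:
  assumes at: "atomic_form p \<mu> X A"
  shows "representing_measure p n L \<mu> \<longleftrightarrow> is_quadrature X (\<lambda>x c d. A x $$ (c, d))"
  using representing_measure_atomic_iff[OF linear at] at by (simp add: is_quadrature_def atomic_form_def)

lemma atomic_form_cut_out:
  assumes at: "atomic_form p \<mu> X A"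
  obtains \<phi> where "cut_out_by (\<lambda>x c d. A x $$ (c, d)) X (\<lambda>x. mat_rank (A x)) \<phi>"
proof -
  have "\<forall>x\<in>X. \<exists>\<phi>. \<forall>v. (\<forall>l<mat_rank (A x). (\<Sum>d<p. \<phi> l d * v d) = 0) \<longrightarrow> (\<forall>c<p. (\<Sum>d<p. A x $$ (c, d) * v d) = 0)"
  proof
    fix x assume "x \<in> X"
    then have "A x \<in> carrier_mat p p" using at by (simp add: atomic_form_def pos_semidef_iff)
    then obtain \<phi> :: "nat \<Rightarrow> nat \<Rightarrow> real" where
      "\<And>q i. (\<And>l. l < mat_rank (A x) \<Longrightarrow> (\<Sum>j<p. \<phi> l j * q j) = 0) \<Longrightarrow> i < p \<Longrightarrow> (\<Sum>j<p. A x $$ (i, j) * q j) = 0"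
      using mat_rank_functionals by blast
    then show "\<exists>\<phi>. \<forall>v. (\<forall>l<mat_rank (A x). (\<Sum>d<p. \<phi> l d * v d) = 0) \<longrightarrow> (\<forall>c<p. (\<Sum>d<p. A x $$ (c, d) * v d) = 0)"
      by blast
  qed
  then obtain \<phi> where "\<forall>x\<in>X. \<forall>v. (\<forall>l<mat_rank (A x). (\<Sum>d<p. \<phi> x l d * v d) = 0)
      \<longrightarrow> (\<forall>c<p. (\<Sum>d<p. A x $$ (c, d) * v d) = 0)"
    unfolding bchoice_iff by blast
  then show ?thesis using that unfolding cut_out_by_def by blast
qed

lemma rank_sum_ge:
  assumes "representing_measure p n L \<mu>" "atomic_form p \<mu> X A"
  shows "Suc n * p \<le> (\<Sum>x\<in>X. mat_rank (A x))"
proof -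
  obtain \<phi> where "cut_out_by (\<lambda>x c d. A x $$ (c, d)) X (\<lambda>x. mat_rank (A x)) \<phi>"
    by (rule atomic_form_cut_out[OF assms(2)])
  then show ?thesis
    using quadrature_size_ge assms representing_iff_quadrature by blast
qed

text \<open>Nodes \<open>x l\<close> may coincide; the weight at \<open>y\<close> collects all rank one terms with \<open>x l = y\<close>, so its rank
  is at most their number. The numbers add up to \<open>(n + 1) p\<close>, which is a lower bound for the sum of the
  ranks. So the ranks are equal to these numbers.\<close>

lemma atomic_measure_of_vectors:
  fixes x :: "nat \<Rightarrow> real" and g :: "nat \<Rightarrow> nat \<Rightarrow> real"
  assumes rep: "\<forall>k\<le>2 * n. \<forall>c<p. \<forall>d<p. s k c d = (\<Sum>l<Suc n * p. x l ^ k * (g l c * g l d))"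
    and nz: "\<forall>l<Suc n * p. \<exists>c<p. g l c \<noteq> 0"
  obtains \<mu> X A where "atomic_form p \<mu> X A" "representing_measure p n L \<mu>"
    "(\<Sum>y\<in>X. mat_rank (A y)) = Suc n * p" "atom_mult \<mu> t = card {l. l < Suc n * p \<and> x l = t}"
proof -
  define F where "F y = {l \<in> {..<Suc n * p}. x l = y}" for y
  define X where "X = x ` {..<Suc n * p}"
  define A where "A y = mat p p (\<lambda>(c, d). \<Sum>l\<in>F y. g l c * g l d)" for y
  have X: "finite X" by (simp add: X_def)
  have F: "finite (F y)" for y by (simp add: F_def)
  have carr: "A y \<in> carrier_mat p p" for y by (simp add: A_def)
  have A_apply: "(\<Sum>d<p. A y $$ (c, d) * v d) = (\<Sum>l\<in>F y. g l c * (\<Sum>d<p. g l d * v d))" if "c < p" for y c v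
  proof -
    have "(\<Sum>d<p. A y $$ (c, d) * v d) = (\<Sum>d<p. \<Sum>l\<in>F y. g l c * (g l d * v d))"
      using that by (intro sum.cong) (auto simp: A_def sum_distrib_right mult.assoc)
    also have "\<dots> = (\<Sum>l\<in>F y. \<Sum>d<p. g l c * (g l d * v d))" by (rule sum.swap)
    finally show ?thesis by (simp add: sum_distrib_left)
  qed
  have psd: "pos_semidef p (A y)" for y
    unfolding pos_semidef_iff
  proof (intro conjI allI impI carr)
    show "A y $$ (c, d) = A y $$ (d, c)" if "c < p" "d < p" for c d
      using that by (simp add: A_def mult.commute)
    fix v
    have "bform {..<p} (\<lambda>c d. A y $$ (c, d)) v v = (\<Sum>c<p. \<Sum>l\<in>F y. g l c * v c * (\<Sum>d<p. g l d * v d))"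
      unfolding bform_mult_right
      by (intro sum.cong refl, subst A_apply) (auto simp: sum_distrib_left mult_ac)
    also have "\<dots> = (\<Sum>l\<in>F y. \<Sum>c<p. g l c * v c * (\<Sum>d<p. g l d * v d))" by (rule sum.swap)
    also have "\<dots> = (\<Sum>l\<in>F y. (\<Sum>d<p. g l d * v d) * (\<Sum>d<p. g l d * v d))"
      by (simp add: sum_distrib_right)
    also have "\<dots> \<ge> 0" by (intro sum_nonneg) simp
    finally show "bform {..<p} (\<lambda>c d. A y $$ (c, d)) v v \<ge> 0" .
  qed
  have A_nz: "A y \<noteq> 0\<^sub>m p p" if "y \<in> X" for y
  proof
    assume zero: "A y = 0\<^sub>m p p"
    obtain l where l: "l < Suc n * p" "x l = y" using \<open>y \<in> X\<close> by (auto simp: X_def)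
    then obtain c where c: "c < p" "g l c \<noteq> 0" using nz by blast
    have "(\<Sum>l\<in>F y. g l c * g l c) > 0"
      using l c F by (intro sum_pos2[of _ l]) (auto simp: F_def zero_less_mult_iff)
    moreover have "A y $$ (c, c) = (\<Sum>l\<in>F y. g l c * g l c)" using c by (simp add: A_def)
    ultimately show False using zero c by simp
  qed
  define \<mu> where "\<mu> \<Delta> = mat p p (\<lambda>(i, j). \<Sum>y\<in>X. A y $$ (i, j) * indicator \<Delta> y)" for \<Delta> :: "real set"
  have at: "atomic_form p \<mu> X A"
    using X psd A_nz by (simp add: atomic_form_def \<mu>_def)
  have "is_quadrature X (\<lambda>x c d. A x $$ (c, d))"
    unfolding is_quadrature_def
  proof (intro conjI X allI impI)
    fix k c d assume k: "k \<le> 2 * n" "c < p" "d < p"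
    then have "s k c d = (\<Sum>l<Suc n * p. x l ^ k * (g l c * g l d))" using rep by blast
    also have "\<dots> = (\<Sum>y\<in>X. \<Sum>l\<in>F y. x l ^ k * (g l c * g l d))"
      unfolding X_def F_def by (rule sum.image_gen) simp
    also have "\<dots> = (\<Sum>y\<in>X. y ^ k * A y $$ (c, d))"
      using k by (intro sum.cong refl) (auto simp: A_def sum_distrib_left F_def)
    finally show "s k c d = (\<Sum>y\<in>X. y ^ k * A y $$ (c, d))" .
  qed
  then have repr: "representing_measure p n L \<mu>" using representing_iff_quadrature[OF at] by simp
  have le: "mat_rank (A y) \<le> card (F y)" for y
    by (rule mat_rank_le_card[OF carr F, where \<phi> = g]) (simp add: A_apply)
  have "(\<Sum>y\<in>X. card (F y)) = Suc n * p"
    using sum.image_gen[of "{..<Suc n * p}" "\<lambda>_. 1 :: nat" x] by (simp add: X_def F_def)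
  moreover have "Suc n * p \<le> (\<Sum>y\<in>X. mat_rank (A y))" by (rule rank_sum_ge[OF repr at])
  moreover have "(\<Sum>y\<in>X. mat_rank (A y)) \<le> (\<Sum>y\<in>X. card (F y))" using le by (intro sum_mono)
  ultimately have total: "(\<Sum>y\<in>X. mat_rank (A y)) = Suc n * p"
    and eq: "(\<Sum>y\<in>X. mat_rank (A y)) = (\<Sum>y\<in>X. card (F y))" by auto
  have rank: "mat_rank (A y) = card (F y)" if "y \<in> X" for y
    using sum_mono_inv[OF eq le that X] .
  have "atom_mult \<mu> t = card (F t)"
  proof (cases "t \<in> X")
    case True
    then show ?thesis using rank by (simp add: atom_mult_atomic[OF at])
  next
    case False
    then have "F t = {}" by (auto simp: F_def X_def)
    then show ?thesis using False by (simp add: atom_mult_atomic[OF at])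
  qed
  then have "atom_mult \<mu> t = card {l. l < Suc n * p \<and> x l = t}" by (simp add: F_def)
  with at repr total show ?thesis using that by blast
qed

text \<open>The lower bound on the total rank is attained: any completion yields a measure of total rank \<open>(n + 1) p\<close>.\<close>

lemma minimal_measure_iff:
  "minimal_measure p n L \<mu> \<longleftrightarrow> representing_measure p n L \<mu> \<and>
     (\<exists>X A. atomic_form p \<mu> X A \<and> (\<Sum>x\<in>X. mat_rank (A x)) = Suc n * p)"
proof -
  obtain x :: "nat \<Rightarrow> real" and g where
    rep: "\<forall>k\<le>2 * n. \<forall>c<p. \<forall>d<p. s k c d = (\<Sum>l<Suc n * p. x l ^ k * (g l c * g l d))"
    and nz: "\<forall>l<Suc n * p. \<exists>c<p. g l c \<noteq> 0"
    by (rule quadrature_exists)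
  obtain \<mu>0 X0 A0 where min: "atomic_form p \<mu>0 X0 A0" "representing_measure p n L \<mu>0"
    "(\<Sum>y\<in>X0. mat_rank (A0 y)) = Suc n * p" "atom_mult \<mu>0 0 = card {l. l < Suc n * p \<and> x l = 0}"
    by (rule atomic_measure_of_vectors[OF rep nz])
  show ?thesis
  proof
    assume "minimal_measure p n L \<mu>"
    then obtain X A where rep: "representing_measure p n L \<mu>" and at: "atomic_form p \<mu> X A"
      and "(\<Sum>x\<in>X. mat_rank (A x)) \<le> (\<Sum>x\<in>X0. mat_rank (A0 x))"
      using min unfolding minimal_measure_def by blast
    then have "(\<Sum>x\<in>X. mat_rank (A x)) = Suc n * p" using rank_sum_ge[OF rep at] min(3) by simp
    then show "representing_measure p n L \<mu> \<and> (\<exists>X A. atomic_form p \<mu> X A \<and> (\<Sum>x\<in>X. mat_rank (A x)) = Suc n * p)"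
      using rep at by blast
  next
    assume "representing_measure p n L \<mu> \<and> (\<exists>X A. atomic_form p \<mu> X A \<and> (\<Sum>x\<in>X. mat_rank (A x)) = Suc n * p)"
    then obtain X A where rep: "representing_measure p n L \<mu>" and at: "atomic_form p \<mu> X A"
      and total: "(\<Sum>x\<in>X. mat_rank (A x)) = Suc n * p" by blast
    show "minimal_measure p n L \<mu>" unfolding minimal_measure_def
    proof (intro conjI exI allI impI)
      show "(\<Sum>x\<in>X. mat_rank (A x)) \<le> (\<Sum>x\<in>X'. mat_rank (A' x))"
        if "representing_measure p n L \<mu>' \<and> atomic_form p \<mu>' X' A'" for \<mu>' X' A'
        unfolding total using rank_sum_ge that by blast
    qed (fact rep at)+
  qed
qed

text \<open>Both directions rest on the description of minimal measures by their total rank. The upper bound on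
  the multiplicity is obtained from the measure itself, the existence from a completion of prescribed nullity.\<close>

theorem minimal_measure_with_multiplicity_iff:
  "(\<exists>\<mu>. minimal_measure p n L \<mu> \<and> atom_mult \<mu> t = m) \<longleftrightarrow> m + n * p \<le> mat_rank (shifted_matrix p n L t) + p"
proof
  assume "\<exists>\<mu>. minimal_measure p n L \<mu> \<and> atom_mult \<mu> t = m"
  then obtain \<mu> X A where rep: "representing_measure p n L \<mu>" and at: "atomic_form p \<mu> X A"
    and total: "(\<Sum>x\<in>X. mat_rank (A x)) = Suc n * p" and m: "atom_mult \<mu> t = m"
    unfolding minimal_measure_iff by blast
  obtain \<phi> where cut: "cut_out_by (\<lambda>x c d. A x $$ (c, d)) X (\<lambda>x. mat_rank (A x)) \<phi>"
    by (rule atomic_form_cut_out[OF at])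
  obtain \<psi> :: "nat \<Rightarrow> nat \<times> nat \<Rightarrow> real" where \<psi>:
    "\<And>q a. (\<And>l. l < mat_rank (shifted_matrix p n L t) \<Longrightarrow> (\<Sum>b\<in>I0. \<psi> l b * q b) = 0) \<Longrightarrow> a \<in> I0 \<Longrightarrow>
       (\<Sum>b\<in>I0. T t a b * q b) = 0"
    using shifted_rank_functionals[of t] by blast
  have "(if t \<in> X then mat_rank (A t) else 0) + n * p \<le> mat_rank (shifted_matrix p n L t) + p"
    using rep total by (intro multiplicity_bound[OF _ cut _ \<psi>]) (simp_all add: representing_iff_quadrature[OF at])
  then show "m + n * p \<le> mat_rank (shifted_matrix p n L t) + p"
    using m by (simp add: atom_mult_atomic[OF at])
next
  assume m: "m + n * p \<le> mat_rank (shifted_matrix p n L t) + p"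
  obtain x :: "nat \<Rightarrow> real" and g where
    rep: "\<forall>k\<le>2 * n. \<forall>c<p. \<forall>d<p. s k c d = (\<Sum>l<Suc n * p. x l ^ k * (g l c * g l d))"
    and nz: "\<forall>l<Suc n * p. \<exists>c<p. g l c \<noteq> 0" and card: "card {l. l < Suc n * p \<and> x l = t} = m"
  proof (rule quadrature_with_multiplicity[OF _ m])
    show "mat_rank (shifted_matrix p n L t) \<le> card K"
      if "finite K" "\<And>q a. (\<And>k. k \<in> K \<Longrightarrow> (\<Sum>b\<in>I0. \<phi> k b * q b) = 0) \<Longrightarrow> a \<in> I0 \<Longrightarrow>
        (\<Sum>b\<in>I0. T t a b * q b) = 0" for K :: "nat set" and \<phi>
      using shifted_rank_le[OF that(1), of \<phi>] that(2) by blast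
  qed
  obtain \<mu> X A where "atomic_form p \<mu> X A" "representing_measure p n L \<mu>"
    "(\<Sum>y\<in>X. mat_rank (A y)) = Suc n * p" "atom_mult \<mu> t = card {l. l < Suc n * p \<and> x l = t}"
    by (rule atomic_measure_of_vectors[OF rep nz])
  then show "\<exists>\<mu>. minimal_measure p n L \<mu> \<and> atom_mult \<mu> t = m"
    unfolding minimal_measure_iff using card by blast
qed

end

theorem theorem1p1:
  fixes n p m :: nat and L :: "real poly \<Rightarrow> real mat" and t :: real
  assumes "n \<ge> 1" and "p \<ge> 1"
    and "linear_op p (2 * n) L"
    and "pos_def ((n + 1) * p) (moment_matrix p n L)"
  shows "(\<exists>\<mu>. minimal_measure p n L \<mu> \<and> atom_mult \<mu> t = m) \<longleftrightarrow>
         int m \<le> int (mat_rank (shifted_matrix p n L t)) - (int n - 1) * int p"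
proof -
  interpret moment_problem n p L by unfold_locales (fact assms)+
  have "int m \<le> int (mat_rank (shifted_matrix p n L t)) - (int n - 1) * int p
      \<longleftrightarrow> int (m + n * p) \<le> int (mat_rank (shifted_matrix p n L t) + p)"
    by (simp add: algebra_simps)
  then show ?thesis
    unfolding minimal_measure_with_multiplicity_iff by (simp only: of_nat_le_iff)
qed

end
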